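(* Let $k\ge 1$ and let $\mathcal{M}=(S,f,\mathcal{B})$ be a $k$-machine. Then there exist $\mathcal{M}$-good $k$-uniform directed hypergraphs of arbitrarily large chromatic number if and only if there is an order system on $S\times[k]$ which is compatible with $\mathcal{M}$. Furthermore, if the chromatic numbers of $\mathcal{M}$-good $k$-uniform directed hypergraphs are bounded, then every $\mathcal{M}$-good $k$-uniform directed hypergraph has chromatic number at most the number of possible order systems on $S$.
   Context: $[k]=\{1,\dots,k\}$, $\mathcal{P}(S)$ is the power set of $S$. A $k$-uniform directed hypergraph is a pair $\mathcal{H}=(V,E)$ with $E\subseteq V^k$, where no edge $e=(e_1,\dots,e_k)\in E$ has two equal coordinates. Its chromatic number is the least $\chi$ (possibly infinite) such that there is a map $c:V\to[\chi]$ such that for no edge $e\in E$ are $c(e_1),\dots,c(e_k)$ all equal. A $k$-machine is a triple $\mathcal{M}=(S,f,\mathcal{B})$ where $S$ is a finite set of states, $f:S\times[k]^2\to\mathcal{P}(S)$, and $\mathcal{B}\subseteq S\times S$. A cycle of $\mathcal{H}$ is a sequence $c=(v_0,e_1,v_1,\dots,e_n,v_n)$ with $n\ge 0$ (length-$0$ cycles included), $e_i\in E$, $v_n=v_0$, and $v_{i-1},v_i\in\{(e_i)_1,\dots,(e_i)_k\}$; its trace is $\mathrm{tr}(c,i)=(a,b)$ where $(e_i)_a=v_{i-1}$, $(e_i)_b=v_i$. A cycle $c$ is $\mathcal{M}$-bad if there are states $s_0,\dots,s_n\in S$ with $s_i\in f(s_{i-1},\mathrm{tr}(c,i))$ for $1\le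 i\le n$ and $(s_0,s_n)\in\mathcal{B}$; $\mathcal{H}$ is $\mathcal{M}$-good if it has no $\mathcal{M}$-bad cycle. An order system on a set $X$ is a triple $(\sim,\preceq,\le)$ where $\sim$ is an equivalence relation on $X$, $\preceq$ is a partial order on $X/\!\sim$, and $\le$ is a total order on $X/\!\sim$ extending $\preceq$. An order system $(\sim,\preceq,\le)$ on $S\times[k]$ is compatible with $\mathcal{M}$ if: (1) whenever $t\in f(s,(i,j))$, we have $((s,i)/\!\sim)\preceq((t,j)/\!\sim)$; (2) the order systems induced on $S$ via $s\mapsto(s,i)$ (i.e. restricting $\sim,\preceq,\le$ to $S\times\{i\}$ and identifying it with $S$) are the same for all $i\in[k]$; (3) for any $s,t\in S$ with $(s/\!\sim)\preceq(t/\!\sim)$ in this induced order system on $S$, we have $(s,t)\notin\mathcal{B}$. *)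

theory Defs
  imports Main "HOL-Library.Extended_Nat" "HOL-Library.FuncSet"
begin

text \<open>
  A $k$-tuple is a list of length $k$; coordinates are numbered from $1$, so that the index set
  is literally $[k] = \{1,\dots,k\}$.
\<close>

definition coord :: "'v list \<Rightarrow> nat \<Rightarrow> 'v" where
  "coord e a = e ! (a - 1)"

definition uniform_dihypergraph :: "nat \<Rightarrow> 'v set \<Rightarrow> 'v list set \<Rightarrow> bool" where
  "uniform_dihypergraph k V E \<longleftrightarrow>
     (\<forall>e\<in>E. length e = k \<and> set e \<subseteq> V \<and> distinct e)"

definition proper_colouring :: "nat \<Rightarrow> 'v set \<Rightarrow> 'v list set \<Rightarrow> nat \<Rightarrow> ('v \<Rightarrow> nat) \<Rightarrow> bool" where
  "proper_colouring k V E \<chi> c \<longleftrightarrow>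
     c \<in> V \<rightarrow> {1..\<chi>} \<and>
     (\<forall>e\<in>E. \<not> (\<forall>a\<in>{1..k}. \<forall>b\<in>{1..k}. c (coord e a) = c (coord e b)))"

text \<open>The infimum of the empty set in \<^typ>\<open>enat\<close> is \<open>\<infinity>\<close>.\<close>

definition chromatic_number :: "nat \<Rightarrow> 'v set \<Rightarrow> 'v list set \<Rightarrow> enat" where
  "chromatic_number k V E = Inf {enat \<chi> |\<chi>. \<exists>c. proper_colouring k V E \<chi> c}"

definition machine ::
  "nat \<Rightarrow> 's set \<Rightarrow> ('s \<Rightarrow> nat \<times> nat \<Rightarrow> 's set) \<Rightarrow> ('s \<times> 's) set \<Rightarrow> bool" where
  "machine k S f B \<longleftrightarrow>
     finite S \<and> (\<forall>s\<in>S. \<forall>i\<in>{1..k}. \<forall>j\<in>{1..k}. f s (i, j) \<subseteq> S) \<and> B \<subseteq> S \<times> S"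

text \<open>
  The sequence $(v_0,e_1,v_1,\dots,e_n,v_n)$ is given by its length \<open>n\<close> and two functions, of
  which only \<open>v 0, \<dots>, v n\<close> and \<open>e 1, \<dots>, e n\<close> matter.
\<close>

definition is_cycle ::
  "'v set \<Rightarrow> 'v list set \<Rightarrow> nat \<Rightarrow> (nat \<Rightarrow> 'v) \<Rightarrow> (nat \<Rightarrow> 'v list) \<Rightarrow> bool" where
  "is_cycle V E n v e \<longleftrightarrow>
     (\<forall>i\<in>{0..n}. v i \<in> V) \<and> v n = v 0 \<and>
     (\<forall>i\<in>{1..n}. e i \<in> E \<and> v (i - 1) \<in> set (e i) \<and> v i \<in> set (e i))"

text \<open>The two indices are unique because edges have distinct coordinates.\<close>

definition trace ::
  "nat \<Rightarrow> (nat \<Rightarrow> 'v) \<Rightarrow> (nat \<Rightarrow> 'v list) \<Rightarrow> nat \<Rightarrow> nat \<times> nat" where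
  "trace k v e i =
     (THE (a, b). a \<in> {1..k} \<and> b \<in> {1..k} \<and> coord (e i) a = v (i - 1) \<and> coord (e i) b = v i)"

definition bad_cycle ::
  "nat \<Rightarrow> 's set \<Rightarrow> ('s \<Rightarrow> nat \<times> nat \<Rightarrow> 's set) \<Rightarrow> ('s \<times> 's) set
     \<Rightarrow> nat \<Rightarrow> (nat \<Rightarrow> 'v) \<Rightarrow> (nat \<Rightarrow> 'v list) \<Rightarrow> bool" where
  "bad_cycle k S f B n v e \<longleftrightarrow>
     (\<exists>s :: nat \<Rightarrow> 's. (\<forall>i\<in>{0..n}. s i \<in> S) \<and>
        (\<forall>i\<in>{1..n}. s i \<in> f (s (i - 1)) (trace k v e i)) \<and> (s 0, s n) \<in> B)"

definition good_hypergraph ::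
  "nat \<Rightarrow> 's set \<Rightarrow> ('s \<Rightarrow> nat \<times> nat \<Rightarrow> 's set) \<Rightarrow> ('s \<times> 's) set
     \<Rightarrow> 'v set \<Rightarrow> 'v list set \<Rightarrow> bool" where
  "good_hypergraph k S f B V E \<longleftrightarrow>
     \<not> (\<exists>n v e. is_cycle V E n v e \<and> bad_cycle k S f B n v e)"

text \<open>
  The components of a triple are $\sim$, $\preceq$ and $\le$, the last two being relations between
  $\sim$-classes; the class $x/{\sim}$ is \<open>sim `` {x}\<close>.
\<close>

type_synonym 'a order_triple =
  "('a \<times> 'a) set \<times> ('a set \<times> 'a set) set \<times> ('a set \<times> 'a set) set"

definition order_system :: "'a set \<Rightarrow> 'a order_triple \<Rightarrow> bool" where
  "order_system X = (\<lambda>(sim, prec, le).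
     equiv X sim \<and> partial_order_on (X // sim) prec \<and> linear_order_on (X // sim) le \<and> prec \<subseteq> le)"

definition induced_sim :: "('b \<Rightarrow> 'a) \<Rightarrow> 'b set \<Rightarrow> ('a \<times> 'a) set \<Rightarrow> ('b \<times> 'b) set" where
  "induced_sim g Y sim = {(y, z). y \<in> Y \<and> z \<in> Y \<and> (g y, g z) \<in> sim}"

definition induced_rel ::
  "('b \<Rightarrow> 'a) \<Rightarrow> 'b set \<Rightarrow> ('a \<times> 'a) set \<Rightarrow> ('a set \<times> 'a set) set \<Rightarrow> ('b set \<times> 'b set) set" where
  "induced_rel g Y sim R =
     {(induced_sim g Y sim `` {y}, induced_sim g Y sim `` {z}) |y z.
        y \<in> Y \<and> z \<in> Y \<and> (sim `` {g y}, sim `` {g z}) \<in> R}"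

definition induced_system :: "('b \<Rightarrow> 'a) \<Rightarrow> 'b set \<Rightarrow> 'a order_triple \<Rightarrow> 'b order_triple" where
  "induced_system g Y = (\<lambda>(sim, prec, le).
     (induced_sim g Y sim, induced_rel g Y sim prec, induced_rel g Y sim le))"

definition compatible ::
  "nat \<Rightarrow> 's set \<Rightarrow> ('s \<Rightarrow> nat \<times> nat \<Rightarrow> 's set) \<Rightarrow> ('s \<times> 's) set
     \<Rightarrow> ('s \<times> nat) order_triple \<Rightarrow> bool" where
  "compatible k S f B = (\<lambda>(sim, prec, le).
     (\<forall>s\<in>S. \<forall>i\<in>{1..k}. \<forall>j\<in>{1..k}. \<forall>t\<in>f s (i, j). (sim `` {(s, i)}, sim `` {(t, j)}) \<in> prec) \<and>
     (\<forall>i\<in>{1..k}. \<forall>j\<in>{1..k}.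
        induced_system (\<lambda>s. (s, i)) S (sim, prec, le) =
        induced_system (\<lambda>s. (s, j)) S (sim, prec, le)) \<and>
     (\<forall>i\<in>{1..k}. \<forall>s\<in>S. \<forall>t\<in>S.
        (induced_sim (\<lambda>s. (s, i)) S sim `` {s}, induced_sim (\<lambda>s. (s, i)) S sim `` {t})
          \<in> induced_rel (\<lambda>s. (s, i)) S sim prec
        \<longrightarrow> (s, t) \<notin> B))"

end

theory Submission
  imports Defs "HOL-Library.Infinite_Set" "HOL-Library.Countable"
begin

text \<open>
  Let \<open>H\<close> be a good hypergraph. Reachability by the machine is a preorder on the pairs of a vertex
  and a state; extend it to a total preorder and colour each vertex \<open>v\<close> by the order system
  induced on \<open>S\<close> via \<open>s \<mapsto> (v, s)\<close>. If this colouring is not proper, a monochromatic edge \<open>e\<close>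
  yields a compatible order system via \<open>(s, i) \<mapsto> (e\<^sub>i, s)\<close>, where condition (3) holds because
  \<open>H\<close> has no bad cycle.

  Conversely, let a compatible order system be given. Take words whose letters are up-sets of
  \<open>S\<close> as vertices, a word that uses all letters being a copy of the order on \<open>S\<close> in a power of the
  two-element chain, and take the restrictions to the copies \<open>S \<times> {i}\<close> of a word of up-sets of
  \<open>S \<times> [k]\<close> as edges. Runs of the machine are monotone in these orders, so there is no bad
  cycle. If up-sets are ordered lexicographically along the total order \<open>\<le>\<close>, then all the \<open>k\<close>
  restrictions from up-sets of \<open>S \<times> [k]\<close> to up-sets of \<open>S\<close> are rigid surjections, and the dual
  Ramsey theorem of Graham and Rothschild provides a monochromatic edge in every finite colouring.
\<close>

text \<open>A pair of a vertex and a state is represented by the set of positions of the word whose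
  letter contains the state. Every column of an edge is an up-set of the whole of
  \<open>S \<times> {1..k}\<close>, so by condition (1) a run can only enlarge this set. Each vertex
  uses the principal up-set of \<open>s\<close> as a letter; a run that returns to it in state
  \<open>t\<close> has \<open>t\<close> in that up-set, and condition (3) excludes
  \<open>(s, t)\<close> from \<open>B\<close>.

  The total order serves Ramsey theory: among arbitrary surjections a colouring can read off the
  order in which the letters first appear. Condition (2) makes the restrictions words over one
  alphabet that respect one such order. In the other direction the total order costs nothing, since
  every preorder extends to a total one with the same equivalence.

  The hypergraph constructed has infinite chromatic number, so one hypergraph serves for all bounds.
  The dual Ramsey theorem is derived from Hales--Jewett; its induction turns the first variable
  letter into a constant and cuts words at places not known in advance, so words of all lengths up
  to a bound are treated together.\<close>

text \<open>The device for applying one Ramsey statement inside another: \<open>y\<close> is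
  coloured by the whole function \<open>w \<mapsto> c w y\<close> on \<open>C\<close>.
  \<open>R\<close> depends only on \<open>C\<close> and \<open>r\<close>, so it can be handed to the
  next statement before the colouring is known.\<close>

lemma product_colouring:
  fixes C :: "'x set"
  assumes "finite C"
  shows "\<exists>R. \<forall>c :: 'x \<Rightarrow> 'y \<Rightarrow> nat. (\<forall>w y. c w y < r) \<longrightarrow>
    (\<exists>d :: 'y \<Rightarrow> nat. (\<forall>y. d y < R) \<and> (\<forall>y y'. d y = d y' \<longrightarrow> (\<forall>w\<in>C. c w y = c w y')))"
proof -
  define T where "T = C \<rightarrow>\<^sub>E {..<r}"
  have "finite T"
    unfolding T_def by (intro finite_PiE assms) auto
  then obtain enc where enc: "bij_betw enc T {0..<card T}"
    using ex_bij_betw_finite_nat by blast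
  have "\<exists>d. (\<forall>y. d y < card T) \<and> (\<forall>y y'. d y = d y' \<longrightarrow> (\<forall>w\<in>C. c w y = c w y'))"
    if c: "\<forall>w y. c w y < r" for c :: "'x \<Rightarrow> 'y \<Rightarrow> nat"
  proof (intro exI[of _ "\<lambda>y. enc (\<lambda>w\<in>C. c w y)"] conjI allI impI ballI)
    have in_T: "(\<lambda>w\<in>C. c w y) \<in> T" for y
      using c by (auto simp: T_def)
    show "enc (\<lambda>w\<in>C. c w y) < card T" for y
      using bij_betwE[OF enc] in_T[of y] by auto
    show "c w y = c w y'" if "enc (\<lambda>w\<in>C. c w y) = enc (\<lambda>w\<in>C. c w y')" "w \<in> C" for y y' w
    proof -
      have "(\<lambda>w\<in>C. c w y) = (\<lambda>w\<in>C. c w y')"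
        using inj_onD[OF bij_betw_imp_inj_on[OF enc] that(1) in_T in_T] .
      then show ?thesis
        using \<open>w \<in> C\<close> by (metis restrict_apply')
    qed
  qed
  then show ?thesis by blast
qed

lemma finite_short_words: "finite {w :: nat list. set w \<subseteq> {..<a} \<and> length w \<le> n}"
  by (rule finite_lists_length_le) simp


section \<open>The Hales--Jewett theorem\<close>

text \<open>The root of a combinatorial line over \<open>{..<a}\<close>. With the letter
  \<open>a\<close> itself as the variable, \<open>q\<close> is the point of its own line at
  \<open>a\<close> once the alphabet grows to \<open>{..a}\<close>.\<close>

definition variable_word :: "nat \<Rightarrow> nat list \<Rightarrow> bool" where
  "variable_word a q \<longleftrightarrow> set q \<subseteq> {..a} \<and> a \<in> set q"

definition subst_var :: "nat \<Rightarrow> nat list \<Rightarrow> nat \<Rightarrow> nat list" where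
  "subst_var a q y = map (\<lambda>v. if v = a then y else v) q"

lemma subst_var_append: "subst_var a (p @ q) y = subst_var a p y @ subst_var a q y"
  by (simp add: subst_var_def)

lemma length_subst_var [simp]: "length (subst_var a q y) = length q"
  by (simp add: subst_var_def)

lemma subst_var_constant: "a \<notin> set q \<Longrightarrow> subst_var a q y = q"
  unfolding subst_var_def by (rule map_idI) auto

lemma set_subst_var: "variable_word a q \<Longrightarrow> set (subst_var a q y) \<subseteq> insert y {..<a}"
  by (auto simp: variable_word_def subst_var_def)

lemma subst_var_rename:
  assumes "set q \<subseteq> {..a}"
  shows "subst_var (Suc a) (subst_var a q (Suc a)) y = subst_var a q y"
  using assms by (auto simp: subst_var_def)

lemma subst_var_self [simp]: "subst_var a q a = q"
  by (auto simp: subst_var_def intro: map_idI)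

lemma variable_word_rename:
  "variable_word a q \<Longrightarrow> variable_word (Suc a) (subst_var a q (Suc a))"
  by (auto simp: variable_word_def subst_var_def)

lemma variable_word_append:
  "variable_word a p \<Longrightarrow> set q \<subseteq> {..a} \<Longrightarrow> variable_word a (p @ q)"
  "set p \<subseteq> {..a} \<Longrightarrow> variable_word a q \<Longrightarrow> variable_word a (p @ q)"
  by (auto simp: variable_word_def)

text \<open>Hales--Jewett with a bound on the length in place of a fixed length, which spares
  padding when blocks are concatenated.\<close>

definition hj :: "nat \<Rightarrow> bool" where
  "hj a \<longleftrightarrow> (\<forall>r. \<exists>n. \<forall>c :: nat list \<Rightarrow> nat. (\<forall>x. c x < r) \<longrightarrow>
     (\<exists>q. variable_word a q \<and> length q \<le> n \<and>
        (\<forall>x<a. \<forall>y<a. c (subst_var a q x) = c (subst_var a q y))))"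

text \<open>
  For \<open>j = r\<close> the common last point \<open>F\<close> of the \<open>j\<close> lines has the colour of one of them, which
  is then monochromatic.
\<close>

lemma colour_focusing:
  assumes hj: "hj a" and "0 < a"
  shows "\<exists>n. \<forall>c :: nat list \<Rightarrow> nat. (\<forall>x. c x < r) \<longrightarrow>
     (\<exists>q. variable_word (Suc a) q \<and> length q \<le> n \<and>
        (\<forall>x\<le>a. \<forall>y\<le>a. c (subst_var (Suc a) q x) = c (subst_var (Suc a) q y))) \<or>
     (\<exists>F K. set F \<subseteq> {..a} \<and> length F \<le> n \<and> K \<subseteq> {..<r} \<and> card K = j \<and>
        (\<forall>\<kappa>\<in>K. \<exists>q. variable_word (Suc a) q \<and> subst_var (Suc a) q a = F \<and>
           (\<forall>x<a. c (subst_var (Suc a) q x) = \<kappa>)))"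
proof (induction j)
  case 0
  show ?case
    by (intro exI[of _ 0] allI impI disjI2 exI[of _ "[]"] exI[of _ "{}"]) auto
next
  case (Suc j)
  let ?mono = "\<lambda>n c q. variable_word (Suc a) q \<and> length q \<le> n \<and>
        (\<forall>x\<le>a. \<forall>y\<le>a. (c (subst_var (Suc a) q x) :: nat) = c (subst_var (Suc a) q y))"
  let ?line = "\<lambda>c F \<kappa> q. variable_word (Suc a) q \<and> subst_var (Suc a) q a = F \<and>
           (\<forall>x<a. (c (subst_var (Suc a) q x) :: nat) = \<kappa>)"
  let ?focus = "\<lambda>n c j F K. set F \<subseteq> {..a} \<and> length F \<le> n \<and> K \<subseteq> {..<r} \<and> card K = j \<and>
        (\<forall>\<kappa>\<in>K. \<exists>q. ?line c F \<kappa> q)"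
  obtain n where n: "\<And>c. (\<forall>x. c x < r) \<Longrightarrow> (\<exists>q. ?mono n c q) \<or> (\<exists>F K. ?focus n c j F K)"
    using Suc.IH by blast
  \<comment> \<open>All points on the lines that the induction hypothesis can provide; a suffix
    \<open>y\<close> will be coloured by the colours of \<open>w @ y\<close> for all these
    \<open>w\<close>.\<close>
  let ?C = "{w :: nat list. set w \<subseteq> {..<Suc a} \<and> length w \<le> n}"
  obtain R :: nat where R: "\<And>c :: nat list \<Rightarrow> nat list \<Rightarrow> nat. (\<forall>w y. c w y < r) \<Longrightarrow>
    (\<exists>d. (\<forall>y. d y < R) \<and> (\<forall>y y'. d y = d y' \<longrightarrow> (\<forall>w\<in>?C. c w y = c w y')))"
    using product_colouring[OF finite_short_words[of "Suc a" n], of r] by blast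
  obtain n' where n': "\<And>c. (\<forall>x. c x < R) \<Longrightarrow> \<exists>q. variable_word a q \<and> length q \<le> n' \<and>
        (\<forall>x<a. \<forall>y<a. (c (subst_var a q x) :: nat) = c (subst_var a q y))"
    using hj unfolding hj_def by blast
  have "(\<exists>q. ?mono (n + n') c q) \<or> (\<exists>F K. ?focus (n + n') c (Suc j) F K)"
    if c: "\<forall>x. c x < r" for c
  proof -
    have "\<exists>d. (\<forall>y. d y < R) \<and> (\<forall>y y'. d y = d y' \<longrightarrow> (\<forall>w\<in>?C. c (w @ y) = c (w @ y')))"
      by (rule R) (use c in simp)
    then obtain d where d: "\<forall>y. d y < R"
      "\<And>y y' w. d y = d y' \<Longrightarrow> w \<in> ?C \<Longrightarrow> c (w @ y) = c (w @ y')"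
      by (elim exE conjE) blast
    obtain q where q: "variable_word a q" "length q \<le> n'"
      "\<And>x y. x < a \<Longrightarrow> y < a \<Longrightarrow> d (subst_var a q x) = d (subst_var a q y)"
      using n'[OF d(1)] by blast
    \<comment> \<open>Behind a short \<open>w\<close> the colour does not depend on the point
      \<open>x < a\<close> of the line \<open>q\<close>; the letter \<open>0\<close> stands for all
      of them and is one of them because of \<open>0 < a\<close>.\<close>
    define c1 where "c1 w = c (w @ subst_var a q 0)" for w
    have c1: "c (w @ subst_var a q x) = c1 w" if "x < a" "w \<in> ?C" for w x
      unfolding c1_def using d(2)[OF q(3)] that \<open>0 < a\<close> by blast
    have q0: "set (subst_var a q 0) \<subseteq> {..<a}"
      using set_subst_var[OF q(1)] \<open>0 < a\<close> by auto
    have mono: "\<exists>q. ?mono (n + n') c q" if p: "?mono n c1 p" for p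
    proof (intro exI conjI allI impI)
      show "variable_word (Suc a) (p @ subst_var a q 0)"
        using p q0 by (intro variable_word_append) auto
      show "length (p @ subst_var a q 0) \<le> n + n'"
        using p q(2) by simp
      have "Suc a \<notin> set (subst_var a q 0)"
        using q0 by auto
      show "c (subst_var (Suc a) (p @ subst_var a q 0) x)
          = c (subst_var (Suc a) (p @ subst_var a q 0) y)" if "x \<le> a" "y \<le> a" for x y
      proof -
        have "c1 (subst_var (Suc a) p x) = c1 (subst_var (Suc a) p y)"
          using p that by blast
        then show ?thesis
          using \<open>Suc a \<notin> set (subst_var a q 0)\<close>
          by (simp add: subst_var_append subst_var_constant c1_def)
      qed
    qed
    have "\<forall>w. c1 w < r"
      using c by (simp add: c1_def)
    from n[OF this] consider p where "?mono n c1 p" | F K where "?focus n c1 j F K"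
      by blast
    then show ?thesis
    proof cases
      case 1
      then show ?thesis using mono by blast
    next
      case 2
      \<comment> \<open>Renaming the variable of \<open>q\<close> to \<open>Suc a\<close> frees
        \<open>a\<close> as a letter that can be substituted.\<close>
      define Q where "Q = subst_var a q (Suc a)"
      have Q: "variable_word (Suc a) Q" "subst_var (Suc a) Q y = subst_var a q y" for y
        using q(1) variable_word_rename subst_var_rename unfolding Q_def variable_word_def
        by blast+
      have FC: "F \<in> ?C"
        using 2 by (auto simp: lessThan_Suc_atMost)
      show ?thesis
      proof (cases "c1 F \<in> K")
        case True
        with 2 obtain p where p: "?line c1 F (c1 F) p"
          by meson
        have "c1 (subst_var (Suc a) p x) = c1 F" if "x \<le> a" for x
          using p that by (cases "x = a") auto
        moreover have "length p \<le> n"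
          using p 2 length_subst_var by metis
        ultimately show ?thesis
          using mono[of p] p by simp
      next
        case False
        let ?F = "F @ q"
        \<comment> \<open>The new colour comes from \<open>F @ Q\<close>, which is constant on the
          old block; the old colours come from the diagonal lines \<open>p @ Q\<close>, in which
          both blocks move together. At the letter \<open>a\<close> all of them end in
          \<open>F @ q\<close>.\<close>
        have lines: "\<exists>p. ?line c ?F \<kappa> p" if "\<kappa> \<in> insert (c1 F) K" for \<kappa>
        proof (cases "\<kappa> = c1 F")
          case True
          have "variable_word (Suc a) (F @ Q)"
            using 2 Q(1) by (intro variable_word_append) auto
          moreover have "Suc a \<notin> set F"
            using 2 by auto
          then have "subst_var (Suc a) (F @ Q) x = F @ subst_var a q x" for x
            by (simp add: subst_var_append Q subst_var_constant)
          ultimately show ?thesis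
            using True FC c1 by (intro exI[of _ "F @ Q"]) auto
        next
          case False
          with that have "\<kappa> \<in> K"
            by blast
          with 2 obtain p where p: "?line c1 F \<kappa> p"
            by meson
          have "variable_word (Suc a) (p @ Q)"
            using p Q(1) by (intro variable_word_append) (auto simp: variable_word_def)
          moreover have "c (subst_var (Suc a) (p @ Q) x) = \<kappa>" if "x < a" for x
          proof -
            have "set (subst_var (Suc a) p x) \<subseteq> {..<Suc a}"
              using set_subst_var[of "Suc a" p x] p that by auto
            moreover have "length (subst_var (Suc a) p x) \<le> n"
              using p 2 length_subst_var by metis
            ultimately have "subst_var (Suc a) p x \<in> ?C"
              by blast
            then show ?thesis
              using p that c1 by (simp add: subst_var_append Q)
          qed
          ultimately show ?thesis
            using p by (intro exI[of _ "p @ Q"]) (simp add: subst_var_append Q)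
        qed
        have K: "K \<subseteq> {..<r}" "card K = j" and F: "set F \<subseteq> {..a}" "length F \<le> n"
          using 2 by blast+
        then have "finite K"
          by (blast intro: finite_subset)
        then have "card (insert (c1 F) K) = Suc j"
          using False K by simp
        moreover have "insert (c1 F) K \<subseteq> {..<r}"
          using K \<open>\<forall>w. c1 w < r\<close> by auto
        moreover have "set ?F \<subseteq> {..a}" "length ?F \<le> n + n'"
          using F q(1,2) by (auto simp: variable_word_def)
        ultimately show ?thesis
          using lines by meson
      qed
    qed
  qed
  then show ?case by blast
qed

theorem hales_jewett: "hj a"
proof (induction a)
  case 0
  show ?case
    unfolding hj_def
    by (intro allI exI[of _ 1] impI exI[of _ "[0]"]) (auto simp: variable_word_def)
next
  case (Suc a)
  show ?case
  \<comment> \<open>A one-letter alphabet has one-point lines; colour focusing asks for a letter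
    below \<open>a\<close>.\<close>
  proof (cases "a = 0")
    case True
    show ?thesis
      unfolding hj_def True
      by (intro allI exI[of _ 1] impI exI[of _ "[1]"]) (auto simp: variable_word_def)
  next
    case False
    show ?thesis
      unfolding hj_def
    proof
      fix r
      obtain n where n: "\<And>c :: nat list \<Rightarrow> nat. (\<forall>x. c x < r) \<Longrightarrow>
        (\<exists>q. variable_word (Suc a) q \<and> length q \<le> n \<and>
          (\<forall>x\<le>a. \<forall>y\<le>a. c (subst_var (Suc a) q x) = c (subst_var (Suc a) q y))) \<or>
        (\<exists>F K. set F \<subseteq> {..a} \<and> length F \<le> n \<and> K \<subseteq> {..<r} \<and> card K = r \<and>
          (\<forall>\<kappa>\<in>K. \<exists>q. variable_word (Suc a) q \<and> subst_var (Suc a) q a = F \<and>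
             (\<forall>x<a. c (subst_var (Suc a) q x) = \<kappa>)))"
        using colour_focusing[OF Suc.IH, of r r] False by blast
      have "\<exists>q. variable_word (Suc a) q \<and> length q \<le> n \<and>
        (\<forall>x<Suc a. \<forall>y<Suc a. c (subst_var (Suc a) q x) = c (subst_var (Suc a) q y))"
        if c: "\<forall>x. c x < r" for c :: "nat list \<Rightarrow> nat"
        using n[OF c]
      proof (elim disjE exE conjE)
        fix F K
        assume F: "length F \<le> n" "K \<subseteq> {..<r}" "card K = r"
          "\<forall>\<kappa>\<in>K. \<exists>q. variable_word (Suc a) q \<and> subst_var (Suc a) q a = F \<and>
             (\<forall>x<a. c (subst_var (Suc a) q x) = \<kappa>)"
        have "K = {..<r}"
          using F by (intro card_subset_eq) auto
        then obtain q where q: "variable_word (Suc a) q" "subst_var (Suc a) q a = F"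
          "\<forall>x<a. c (subst_var (Suc a) q x) = c F"
          using F(4) c by blast
        have "c (subst_var (Suc a) q x) = c F" if "x < Suc a" for x
          using q that by (cases "x = a") auto
        moreover have "length q \<le> n"
          using F(1) q(2) length_subst_var by metis
        ultimately show ?thesis
          using q(1) by auto
      qed (auto simp: less_Suc_eq_le)
      then show "\<exists>n. \<forall>c :: nat list \<Rightarrow> nat. (\<forall>x. c x < r) \<longrightarrow>
        (\<exists>q. variable_word (Suc a) q \<and> length q \<le> n \<and>
          (\<forall>x<Suc a. \<forall>y<Suc a. c (subst_var (Suc a) q x) = c (subst_var (Suc a) q y)))"
        by blast
    qed
  qed
qed

section \<open>Rigid words and expansions\<close>

text \<open>Constants count as seen from the start. For a letter that does not occur, the whole word
  has been seen, so the values at large \<open>v\<close> also record which letters occur: the one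
  family of equations in \<open>rigid\<close> fixes both the set of letters and the order of first
  appearances.\<close>

definition seen_before :: "nat \<Rightarrow> nat list \<Rightarrow> nat \<Rightarrow> nat set" where
  "seen_before a g v = {..<a} \<union> set (takeWhile (\<lambda>x. x \<noteq> v) g)"

text \<open>
  Words over the constants \<open>0, \<dots>, a - 1\<close> in which the further letters \<open>a, \<dots>, b - 1\<close> all occur
  and make their first appearances in increasing order.
\<close>

definition rigid :: "nat \<Rightarrow> nat \<Rightarrow> nat list \<Rightarrow> bool" where
  "rigid a b g \<longleftrightarrow> a \<le> b \<and> (\<forall>v\<ge>a. seen_before a g v = {..<min v b})"

text \<open>
  The substitution maps of parameter words over the constants \<open>0, \<dots>, a - 1\<close>: a map that commutes
  with relabelling of the letters is given by substitution into a word with parameters.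
\<close>

definition expansion :: "nat \<Rightarrow> (nat list \<Rightarrow> nat list) \<Rightarrow> bool" where
  "expansion a \<Phi> \<longleftrightarrow>
     (\<forall>\<sigma> g. (\<forall>v<a. \<sigma> v = v) \<longrightarrow> \<Phi> (map \<sigma> g) = map \<sigma> (\<Phi> g)) \<and>
     (\<forall>g v. a \<le> v \<longrightarrow> seen_before a (\<Phi> g) v = seen_before a g v) \<and>
     (\<forall>g y t. a \<le> y \<longrightarrow> y \<notin> set g \<longrightarrow> (\<exists>t'. \<Phi> (g @ y # t) = \<Phi> g @ y # t'))"

lemma expansionD:
  assumes "expansion a \<Phi>"
  shows "(\<And>v. v < a \<Longrightarrow> \<sigma> v = v) \<Longrightarrow> \<Phi> (map \<sigma> g) = map \<sigma> (\<Phi> g)"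
    and "a \<le> v \<Longrightarrow> seen_before a (\<Phi> g) v = seen_before a g v"
    and "a \<le> y \<Longrightarrow> y \<notin> set g \<Longrightarrow> \<exists>t'. \<Phi> (g @ y # t) = \<Phi> g @ y # t'"
  using assms unfolding expansion_def by blast+

lemma seen_before_append:
  "seen_before a (x @ y) v =
     (if v \<in> set x then seen_before a x v else set x \<union> seen_before a y v)"
  unfolding seen_before_def by (auto simp: takeWhile_append)

lemma seen_before_Cons:
  "seen_before a (x # g) v = (if x = v then {..<a} else insert x (seen_before a g v))"
  by (cases "x = v") (auto simp: seen_before_def)

lemma seen_before_absorb: "{..<a} \<union> seen_before a g v = seen_before a g v"
  by (auto simp: seen_before_def)

lemma seen_before_notin: "v \<notin> set g \<Longrightarrow> seen_before a g v = {..<a} \<union> set g"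
proof -
  assume "v \<notin> set g"
  then have "takeWhile (\<lambda>x. x \<noteq> v) g = g"
    by (auto simp: takeWhile_eq_all_conv)
  then show ?thesis
    by (simp only: seen_before_def)
qed

text \<open>At a letter that occurs in neither word, \<open>seen_before\<close> is the set of all
  letters and constants.\<close>

lemma expansion_set:
  assumes "expansion a \<Phi>"
  shows "{..<a} \<union> set (\<Phi> g) = {..<a} \<union> set g"
proof -
  have "finite (set (\<Phi> g) \<union> set g \<union> {..<a})"
    by simp
  then obtain v where v: "v \<notin> set (\<Phi> g) \<union> set g \<union> {..<a}"
    by (rule ex_new_if_finite[OF infinite_UNIV_nat, THEN exE])
  then have "seen_before a (\<Phi> g) v = seen_before a g v"
    using assms by (intro expansionD) auto
  then show ?thesis
    using v by (simp add: seen_before_notin)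
qed

lemma expansion_mem_iff: "expansion a \<Phi> \<Longrightarrow> a \<le> v \<Longrightarrow> v \<in> set (\<Phi> g) \<longleftrightarrow> v \<in> set g"
  using expansion_set[of a \<Phi> g] by (metis UnE UnI2 lessThan_iff not_le)

lemma rigid_set:
  assumes "rigid a b g"
  shows "{..<a} \<union> set g = {..<b}"
proof -
  have "finite (set g \<union> {..<b})"
    by simp
  then obtain v where v: "v \<notin> set g \<union> {..<b}"
    by (rule ex_new_if_finite[OF infinite_UNIV_nat, THEN exE])
  then have "seen_before a g v = {..<b}"
    using assms by (auto simp: rigid_def min_def)
  then show ?thesis
    using v by (simp add: seen_before_notin)
qed

lemma rigid_expansion: "expansion a \<Phi> \<Longrightarrow> rigid a b g \<Longrightarrow> rigid a b (\<Phi> g)"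
  by (simp add: rigid_def expansionD(2))

lemma rigid_self_iff: "rigid a a w \<longleftrightarrow> set w \<subseteq> {..<a}"
proof
  assume "rigid a a w"
  from rigid_set[OF this] show "set w \<subseteq> {..<a}" by blast
next
  assume w: "set w \<subseteq> {..<a}"
  then have "seen_before a w v = {..<a}" if "a \<le> v" for v
    using that by (subst seen_before_notin) auto
  then show "rigid a a w"
    by (auto simp: rigid_def min_def)
qed

text \<open>From the first \<open>a\<close> on, this letter counts as seen and so behaves like one
  more constant. This drives the induction on \<open>b - a\<close> for the dual Ramsey
  theorem.\<close>

lemma rigid_append_Cons_iff:
  assumes "set w \<subseteq> {..<a}"
  shows "rigid a b (w @ a # t) \<longleftrightarrow> a < b \<and> rigid (Suc a) b t"
proof -
  have new: "v \<notin> set w" if "a \<le> v" for v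
    using assms that by auto
  have a: "seen_before a (w @ a # t) a = {..<a}"
    using assms new by (auto simp: seen_before_append seen_before_Cons)
  have v: "seen_before a (w @ a # t) v = seen_before (Suc a) t v" if "Suc a \<le> v" for v
    using assms new[of v] that by (auto simp: seen_before_append seen_before_Cons) (auto simp: seen_before_def less_Suc_eq)
  show ?thesis
  proof
    assume r: "rigid a b (w @ a # t)"
    then have "{..<a} = {..<min a b}" "a \<le> b"
      using a by (auto simp: rigid_def)
    moreover have "a \<in> {..<b}"
      using rigid_set[OF r] by auto
    ultimately show "a < b \<and> rigid (Suc a) b t"
      using r v by (auto simp: rigid_def)
  next
    assume r: "a < b \<and> rigid (Suc a) b t"
    have "seen_before a (w @ a # t) x = {..<min x b}" if "a \<le> x" for x
      using r v[of x] a that by (cases "x = a") (auto simp: rigid_def)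
    then show "rigid a b (w @ a # t)"
      using r by (auto simp: rigid_def)
  qed
qed

lemma rigid_split:
  assumes "rigid a b g" "a < b"
  obtains w t where "g = w @ a # t" "set w \<subseteq> {..<a}" "rigid (Suc a) b t"
proof -
  have "a \<in> set g"
    using rigid_set[OF assms(1)] assms(2) by auto
  then obtain w t where g: "g = w @ a # t" "a \<notin> set w"
    by (meson split_list_first)
  have "seen_before a g a = {..<a}"
    using assms by (simp add: rigid_def)
  then have "set w \<subseteq> {..<a}"
    using g by (auto simp: seen_before_append)
  moreover from this have "rigid (Suc a) b t"
    using assms(1) g(1) rigid_append_Cons_iff by blast
  ultimately show thesis
    using that g(1) by blast
qed

lemma rigid_upt: "a \<le> b \<Longrightarrow> rigid a b [a..<b]"
proof (induction "b - a" arbitrary: a)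
  case 0
  then show ?case
    by (simp add: rigid_self_iff)
next
  case (Suc d)
  then have "rigid (Suc a) b [Suc a..<b]" "a < b"
    by auto
  then show ?case
    using rigid_append_Cons_iff[of "[]" a b "[Suc a..<b]"] by (simp add: upt_conv_Cons)
qed

lemma expansion_id: "expansion a (\<lambda>g. g)"
  by (auto simp: expansion_def)

lemma expansion_comp:
  assumes \<Phi>: "expansion a \<Phi>" and \<Psi>: "expansion a \<Psi>"
  shows "expansion a (\<lambda>g. \<Phi> (\<Psi> g))"
  unfolding expansion_def
proof (intro conjI allI impI)
  show "\<Phi> (\<Psi> (map \<sigma> g)) = map \<sigma> (\<Phi> (\<Psi> g))" if "\<forall>v<a. \<sigma> v = v" for \<sigma> g
    using that by (simp add: expansionD(1)[OF \<Phi>] expansionD(1)[OF \<Psi>])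
  show "seen_before a (\<Phi> (\<Psi> g)) v = seen_before a g v" if "a \<le> v" for g v
    using that by (simp add: expansionD(2)[OF \<Phi>] expansionD(2)[OF \<Psi>])
  show "\<exists>t'. \<Phi> (\<Psi> (g @ y # t)) = \<Phi> (\<Psi> g) @ y # t'" if "a \<le> y" "y \<notin> set g" for g y t
    using expansionD(3)[OF \<Psi> that, of t] expansionD(3)[OF \<Phi>, of y "\<Psi> g"] that
    by (auto simp: expansion_mem_iff[OF \<Psi>])
qed

lemma expansion_prefix:
  assumes \<Phi>: "expansion a \<Phi>" and p: "set p \<subseteq> {..<a}"
  shows "expansion a (\<lambda>g. p @ \<Phi> g)"
  unfolding expansion_def
proof (intro conjI allI impI)
  show "p @ \<Phi> (map \<sigma> g) = map \<sigma> (p @ \<Phi> g)" if "\<forall>v<a. \<sigma> v = v" for \<sigma> g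
    using that p by (auto simp: expansionD(1)[OF \<Phi>] intro!: map_idI[symmetric])
  show "seen_before a (p @ \<Phi> g) v = seen_before a g v" if "a \<le> v" for g v
    using that p expansionD(2)[OF \<Phi> that, of g]
    by (auto simp: seen_before_append) (auto simp: seen_before_def)
  show "\<exists>t'. p @ \<Phi> (g @ y # t) = (p @ \<Phi> g) @ y # t'" if "a \<le> y" "y \<notin> set g" for g y t
    using expansionD(3)[OF \<Phi> that, of t] by auto
qed

text \<open>
  The empty word is sent to the constants that precede the first variable of \<open>q\<close>, as the
  last clause of \<open>expansion\<close> forces for \<open>g = []\<close>.
\<close>

lemma expansion_block:
  assumes \<Phi>: "expansion a \<Phi>" and q: "variable_word a q"
  shows "expansion a (\<lambda>g. case g of [] \<Rightarrow> takeWhile (\<lambda>x. x \<noteq> a) q | y # g' \<Rightarrow> subst_var a q y @ \<Phi> g')"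
    (is "expansion a ?\<Psi>")
proof -
  let ?p = "takeWhile (\<lambda>x. x \<noteq> a) q"
  have p: "set ?p \<subseteq> {..<a}"
  proof
    fix x
    assume "x \<in> set ?p"
    then have "x \<in> set q \<and> x \<noteq> a"
      by (rule set_takeWhileD)
    then show "x \<in> {..<a}"
      using q by (auto simp: variable_word_def)
  qed
  have set_q: "{..<a} \<union> set (subst_var a q y) = insert y {..<a}" for y
    using q by (auto simp: variable_word_def subst_var_def)
  obtain p0 t0 where p0: "q = p0 @ a # t0" "a \<notin> set p0"
    using q unfolding variable_word_def by (meson split_list_first)
  have "takeWhile (\<lambda>x. x \<noteq> a) p0 = p0"
    using p0(2) by (auto simp: takeWhile_eq_all_conv)
  then have q_split: "q = ?p @ a # t0"
    using p0(1) by (simp add: takeWhile_tail)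
  have subst_split: "subst_var a q y = ?p @ y # subst_var a t0 y" for y
  proof -
    have "subst_var a q y = subst_var a ?p y @ subst_var a (a # t0) y"
      by (subst q_split) (rule subst_var_append)
    also have "subst_var a ?p y = ?p"
      using p by (intro subst_var_constant) auto
    finally show ?thesis
      by (simp add: subst_var_def)
  qed
  show ?thesis
    unfolding expansion_def
  proof (intro conjI allI impI)
    show "?\<Psi> (map \<sigma> g) = map \<sigma> (?\<Psi> g)" if \<sigma>: "\<forall>v<a. \<sigma> v = v" for \<sigma> g
    proof (cases g)
      case Nil
      then show ?thesis
        using \<sigma> p by (auto intro!: map_idI[symmetric])
    next
      case (Cons y g')
      have "subst_var a q (\<sigma> y) = map \<sigma> (subst_var a q y)"
        using q \<sigma> by (auto simp: subst_var_def variable_word_def)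
      then show ?thesis
        using Cons \<sigma> by (simp add: expansionD(1)[OF \<Phi>])
    qed
    show "seen_before a (?\<Psi> g) v = seen_before a g v" if "a \<le> v" for g v
    proof (cases g)
      case Nil
      have "v \<notin> set ?p"
        using p that by auto
      then show ?thesis
        using Nil p by (auto simp: seen_before_notin)
    next
      case (Cons y g')
      show ?thesis
      proof (cases "v = y")
        case True
        have "v \<notin> set ?p"
          using p that by auto
        then have "seen_before a (subst_var a q v @ \<Phi> g') v = {..<a}"
          using p by (auto simp: subst_split seen_before_append seen_before_Cons)
        then show ?thesis
          using Cons True by (simp add: seen_before_Cons)
      next
        case False
        have "v \<notin> insert y {..<a}"
          using False that by simp
        then have "v \<notin> set (subst_var a q y)"
          using set_q[of y] by blast
        then have "seen_before a (?\<Psi> g) v = set (subst_var a q y) \<union> seen_before a g' v"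
          using Cons expansionD(2)[OF \<Phi> that, of g'] by (simp add: seen_before_append)
        also have "\<dots> = ({..<a} \<union> set (subst_var a q y)) \<union> seen_before a g' v"
          using seen_before_absorb[of a g' v] by blast
        also have "\<dots> = insert y (seen_before a g' v)"
          using set_q[of y] seen_before_absorb[of a g' v] by blast
        finally show ?thesis
          using Cons False by (simp add: seen_before_Cons)
      qed
    qed
    show "\<exists>t'. ?\<Psi> (g @ y # t) = ?\<Psi> g @ y # t'" if "a \<le> y" "y \<notin> set g" for g y t
    proof (cases g)
      case Nil
      then show ?thesis
        by (simp add: subst_split)
    next
      case (Cons x g')
      then show ?thesis
        using expansionD(3)[OF \<Phi>, of y g' t] that by auto
    qed
  qed
qed

section \<open>The dual Ramsey theorem\<close>

text \<open>The Graham--Rothschild theorem with expansions in place of parameter words. Words of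
  different lengths up to \<open>M\<close> must receive the same colour too: in the induction it is
  applied to the prefixes before the first \<open>a\<close>, whose lengths vary. The bound
  \<open>n\<close> keeps the words finite in number for the next product colouring.\<close>

definition dual_ramsey :: "nat \<Rightarrow> nat \<Rightarrow> bool" where
  "dual_ramsey a b \<longleftrightarrow> (\<forall>r M. \<exists>n. \<forall>c :: nat list \<Rightarrow> nat. (\<forall>x. c x < r) \<longrightarrow>
     (\<exists>\<Phi>. expansion a \<Phi> \<and> (\<forall>g. length g \<le> M \<longrightarrow> length (\<Phi> g) \<le> n) \<and>
        (\<forall>g g'. rigid a b g \<longrightarrow> rigid a b g' \<longrightarrow> length g \<le> M \<longrightarrow> length g' \<le> M \<longrightarrow>
           c (\<Phi> g) = c (\<Phi> g'))))"

lemma expansion_constant_words: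
  "expansion a \<Phi> \<Longrightarrow> set w \<subseteq> {..<a} \<Longrightarrow> set (\<Phi> w) \<subseteq> {..<a}"
  using expansion_set[of a \<Phi> w] by blast

text \<open>The first letter goes into a Hales--Jewett line \<open>q\<close> along which the colour,
  with any short constant continuation, does not change; the other letters go through the expansion
  that the induction hypothesis gives for the continuations of \<open>subst_var a q 0\<close>. So
  every letter may be replaced by \<open>0\<close>, and only the length is left.\<close>

lemma expansion_colour_by_length:
  "\<exists>n. \<forall>c :: nat list \<Rightarrow> nat. (\<forall>x. c x < r) \<longrightarrow>
     (\<exists>\<Phi>. expansion a \<Phi> \<and> (\<forall>g. length g \<le> M \<longrightarrow> length (\<Phi> g) \<le> n) \<and>
        (\<forall>w w'. set w \<subseteq> {..<a} \<longrightarrow> set w' \<subseteq> {..<a} \<longrightarrow> length w = length w' \<longrightarrow> length w \<le> M \<longrightarrow>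
           c (\<Phi> w) = c (\<Phi> w')))"
proof (induction M)
  case 0
  show ?case
    by (intro exI[of _ 0] allI impI exI[of _ "\<lambda>g. g"]) (simp add: expansion_id)
next
  case (Suc M)
  let ?good = "\<lambda>M n (c :: nat list \<Rightarrow> nat) \<Phi>. expansion a \<Phi> \<and> (\<forall>g. length g \<le> M \<longrightarrow> length (\<Phi> g) \<le> n) \<and>
        (\<forall>w w'. set w \<subseteq> {..<a} \<longrightarrow> set w' \<subseteq> {..<a} \<longrightarrow> length w = length w' \<longrightarrow> length w \<le> M \<longrightarrow>
           c (\<Phi> w) = c (\<Phi> w'))"
  obtain n where n: "\<And>c. (\<forall>x. c x < r) \<Longrightarrow> \<exists>\<Phi>. ?good M n c \<Phi>"
    using Suc.IH by blast
  let ?C = "{w :: nat list. set w \<subseteq> {..<a} \<and> length w \<le> n}"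
  obtain R :: nat where R: "\<And>c :: nat list \<Rightarrow> nat list \<Rightarrow> nat. (\<forall>w y. c w y < r) \<Longrightarrow>
    (\<exists>d. (\<forall>y. d y < R) \<and> (\<forall>y y'. d y = d y' \<longrightarrow> (\<forall>w\<in>?C. c w y = c w y')))"
    using product_colouring[OF finite_short_words[of a n], of r] by blast
  obtain n' where n': "\<And>c. (\<forall>x. c x < R) \<Longrightarrow> \<exists>q. variable_word a q \<and> length q \<le> n' \<and>
        (\<forall>x<a. \<forall>y<a. (c (subst_var a q x) :: nat) = c (subst_var a q y))"
    using hales_jewett unfolding hj_def by blast
  have "\<exists>\<Psi>. ?good (Suc M) (n' + n) c \<Psi>" if c: "\<forall>x. c x < r" for c
  proof -
    have "\<exists>d. (\<forall>y. d y < R) \<and> (\<forall>y y'. d y = d y' \<longrightarrow> (\<forall>w\<in>?C. c (y @ w) = c (y' @ w)))"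
      by (rule R) (use c in simp)
    then obtain d where d: "\<forall>y. d y < R"
      "\<And>y y' w. d y = d y' \<Longrightarrow> w \<in> ?C \<Longrightarrow> c (y @ w) = c (y' @ w)"
      by (elim exE conjE) blast
    obtain q where q: "variable_word a q" "length q \<le> n'"
      "\<And>x y. x < a \<Longrightarrow> y < a \<Longrightarrow> d (subst_var a q x) = d (subst_var a q y)"
      using n'[OF d(1)] by blast
    have "\<forall>w. c (subst_var a q 0 @ w) < r"
      using c by blast
    from n[OF this] obtain \<Phi> where \<Phi>: "expansion a \<Phi>" "\<And>g. length g \<le> M \<Longrightarrow> length (\<Phi> g) \<le> n"
      "\<And>w w'. set w \<subseteq> {..<a} \<Longrightarrow> set w' \<subseteq> {..<a} \<Longrightarrow> length w = length w' \<Longrightarrow> length w \<le> M \<Longrightarrow>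
           c (subst_var a q 0 @ \<Phi> w) = c (subst_var a q 0 @ \<Phi> w')"
      by (elim exE conjE) blast
    let ?\<Psi> = "\<lambda>g. case g of [] \<Rightarrow> takeWhile (\<lambda>x. x \<noteq> a) q | y # g' \<Rightarrow> subst_var a q y @ \<Phi> g'"
    have "expansion a ?\<Psi>"
      by (rule expansion_block[OF \<Phi>(1) q(1)])
    moreover have "length (?\<Psi> g) \<le> n' + n" if "length g \<le> Suc M" for g
    proof (cases g)
      case Nil
      then show ?thesis
        using q(2) length_takeWhile_le[of "\<lambda>x. x \<noteq> a" q] by simp
    next
      case (Cons y g')
      then show ?thesis
        using q(2) \<Phi>(2)[of g'] that by simp
    qed
    moreover have "c (?\<Psi> w) = c (?\<Psi> w')"
      if w: "set w \<subseteq> {..<a}" "set w' \<subseteq> {..<a}" "length w = length w'" "length w \<le> Suc M" for w w'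
    proof (cases w)
      case Nil
      then show ?thesis
        using w by simp
    next
      case (Cons y u)
      then obtain y' u' where w': "w' = y' # u'"
        using w by (cases w') auto
      have u: "set u \<subseteq> {..<a}" "set u' \<subseteq> {..<a}" "length u = length u'" "length u \<le> M" "y < a" "y' < a"
        using w Cons w' by auto
      have step: "c (subst_var a q x @ \<Phi> v) = c (subst_var a q 0 @ \<Phi> v)"
        if "x < a" "set v \<subseteq> {..<a}" "length v \<le> M" for x v
      proof (rule d(2)[OF q(3)])
        show "\<Phi> v \<in> ?C"
          using that expansion_constant_words[OF \<Phi>(1)] \<Phi>(2) by blast
      qed (use that in auto)
      have "c (subst_var a q y @ \<Phi> u) = c (subst_var a q y' @ \<Phi> u')"
        using step[of y u] step[of y' u'] \<Phi>(3)[of u u'] u by simp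
      then show ?thesis
        using Cons w' by simp
    qed
    ultimately show ?thesis
      by blast
  qed
  then show ?case by blast
qed

text \<open>The letter number \<open>i\<close>, counted from \<open>0\<close>, is repeated
  \<open>e (Suc i) - e i\<close> times; strict growth keeps each block nonempty.\<close>

lemma expansion_of_lengths:
  assumes "\<And>i. i < M \<Longrightarrow> e i < e (Suc i)"
  shows "\<exists>\<Psi>. expansion a \<Psi> \<and> (\<forall>g. length g \<le> M \<longrightarrow> length (\<Psi> g) + e 0 = e (length g))"
  using assms
proof (induction M arbitrary: e)
  case 0
  show ?case
    by (intro exI[of _ "\<lambda>g. g"]) (simp add: expansion_id)
next
  case (Suc M)
  obtain \<Psi> where \<Psi>: "expansion a \<Psi>"
    "\<And>g. length g \<le> M \<Longrightarrow> length (\<Psi> g) + e 1 = e (Suc (length g))"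
    using Suc.IH[of "\<lambda>i. e (Suc i)"] Suc.prems by auto
  define q where "q = replicate (e 1 - e 0) a"
  have pos: "e 0 < e 1"
    using Suc.prems[of 0] by simp
  then have q: "variable_word a q" "takeWhile (\<lambda>x. x \<noteq> a) q = []" "length q + e 0 = e 1"
    by (auto simp: q_def variable_word_def takeWhile_replicate)
  let ?\<Psi> = "\<lambda>g. case g of [] \<Rightarrow> takeWhile (\<lambda>x. x \<noteq> a) q | y # g' \<Rightarrow> subst_var a q y @ \<Psi> g'"
  have "length (?\<Psi> g) + e 0 = e (length g)" if "length g \<le> Suc M" for g
  proof (cases g)
    case Nil
    then show ?thesis by (simp add: q)
  next
    case (Cons y g')
    then show ?thesis
      using \<Psi>(2)[of g'] that q(3) by simp
  qed
  then show ?case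
    using expansion_block[OF \<Psi>(1) q(1)] by blast
qed

text \<open>After one expansion the colour depends on the length alone; a second one, applied before
  it, moves the lengths \<open>0, ..., M\<close> to lengths of one colour.\<close>

lemma dual_ramsey_constant_words: "dual_ramsey a a"
  unfolding dual_ramsey_def rigid_self_iff
proof (intro allI)
  fix r M
  let ?goal = "\<lambda>n (c :: nat list \<Rightarrow> nat) \<Phi>. expansion a \<Phi> \<and> (\<forall>g. length g \<le> M \<longrightarrow> length (\<Phi> g) \<le> n) \<and>
        (\<forall>g g'. set g \<subseteq> {..<a} \<longrightarrow> set g' \<subseteq> {..<a} \<longrightarrow> length g \<le> M \<longrightarrow> length g' \<le> M \<longrightarrow>
           c (\<Phi> g) = c (\<Phi> g'))"
  show "\<exists>n. \<forall>c. (\<forall>x. c x < r) \<longrightarrow> (\<exists>\<Phi>. ?goal n c \<Phi>)"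
  \<comment> \<open>Without constants only the empty word is concerned; otherwise the constant
    \<open>0\<close> is available for padding.\<close>
  proof (cases "a = 0")
    case True
    then show ?thesis
      by (intro exI[of _ M] allI impI exI[of _ "\<lambda>g. g"]) (simp add: expansion_id)
  next
    case False
    obtain n where n: "\<And>c :: nat list \<Rightarrow> nat. (\<forall>x. c x < r) \<Longrightarrow>
      (\<exists>\<Phi>. expansion a \<Phi> \<and> (\<forall>g. length g \<le> r * M \<longrightarrow> length (\<Phi> g) \<le> n) \<and>
        (\<forall>w w'. set w \<subseteq> {..<a} \<longrightarrow> set w' \<subseteq> {..<a} \<longrightarrow> length w = length w' \<longrightarrow> length w \<le> r * M \<longrightarrow>
           c (\<Phi> w) = c (\<Phi> w')))"
      using expansion_colour_by_length[of r a "r * M"] by blast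
    have "\<exists>\<Phi>. ?goal n c \<Phi>" if c: "\<forall>x. c x < r" for c
    proof -
      obtain \<Phi> where \<Phi>: "expansion a \<Phi>" "\<And>g. length g \<le> r * M \<Longrightarrow> length (\<Phi> g) \<le> n"
        "\<And>w w'. set w \<subseteq> {..<a} \<Longrightarrow> set w' \<subseteq> {..<a} \<Longrightarrow> length w = length w' \<Longrightarrow> length w \<le> r * M \<Longrightarrow>
           c (\<Phi> w) = c (\<Phi> w')"
        using n[OF c] by (elim exE conjE) blast
      define col where "col i = c (\<Phi> (replicate i 0))" for i
      have "0 < r"
        using c by (metis gr_zeroI not_less_zero)
      \<comment> \<open>Among \<open>r * M + 1\<close> lengths in \<open>r\<close> colours, more
        than \<open>M\<close> share a colour.\<close>
      have "\<exists>\<kappa>\<in>{..<r}. card {..<Suc (r * M)} \<le> card (col -` {\<kappa>} \<inter> {..<Suc (r * M)}) * card {..<r}"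
        by (rule pigeonhole_card) (use c \<open>0 < r\<close> in \<open>auto simp: col_def\<close>)
      then obtain \<kappa> where \<kappa>: "Suc (r * M) \<le> card (col -` {\<kappa>} \<inter> {..<Suc (r * M)}) * r"
        by auto
      define I where "I = col -` {\<kappa>} \<inter> {..<Suc (r * M)}"
      have "r * M < r * card I"
        using \<kappa> unfolding I_def by (metis Suc_le_eq mult.commute)
      then have "M < card I"
        by simp
      have "finite I"
        by (simp add: I_def)
      then obtain e where e: "bij_betw e {..<card I} I" "strict_mono_on {..<card I} e"
        by (rule ex_bij_betw_strict_mono_card)
      have e_I: "e i \<le> r * M" "col (e i) = \<kappa>" if "i \<le> M" for i
        using bij_betwE[OF e(1)] that \<open>M < card I\<close> by (auto simp: I_def less_Suc_eq_le)
      have "e i < e (Suc i)" if "i < M" for i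
        using strict_mono_onD[OF e(2)] that \<open>M < card I\<close> by simp
      then obtain \<Psi> where \<Psi>: "expansion a \<Psi>"
        "\<And>g. length g \<le> M \<Longrightarrow> length (\<Psi> g) + e 0 = e (length g)"
        using expansion_of_lengths[of M e a] by blast
      \<comment> \<open>\<open>\<Psi>\<close> meets the prescribed lengths up to the offset
        \<open>e 0\<close>, which the padding restores.\<close>
      define \<Theta> where "\<Theta> g = replicate (e 0) 0 @ \<Psi> g" for g
      have \<Theta>: "expansion a \<Theta>"
        unfolding \<Theta>_def by (rule expansion_prefix[OF \<Psi>(1)]) (use False in auto)
      have length_\<Theta>: "length (\<Theta> g) = e (length g)" if "length g \<le> M" for g
        using \<Psi>(2)[OF that] by (simp add: \<Theta>_def)
      have "c (\<Phi> (\<Theta> w)) = \<kappa>" if "set w \<subseteq> {..<a}" "length w \<le> M" for w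
      proof -
        have "c (\<Phi> (\<Theta> w)) = c (\<Phi> (replicate (e (length w)) 0))"
          using that length_\<Theta> e_I(1) expansion_constant_words[OF \<Theta>] False
          by (intro \<Phi>(3)) auto
        then show ?thesis
          using e_I(2)[OF that(2)] by (simp add: col_def)
      qed
      moreover have "length (\<Phi> (\<Theta> g)) \<le> n" if "length g \<le> M" for g
        using that length_\<Theta> e_I(1) by (intro \<Phi>(2)) auto
      moreover have "expansion a (\<lambda>g. \<Phi> (\<Theta> g))"
        by (rule expansion_comp[OF \<Phi>(1) \<Theta>])
      ultimately show ?thesis
        by (intro exI[of _ "\<lambda>g. \<Phi> (\<Theta> g)"]) simp
    qed
    then show ?thesis by blast
  qed
qed

text \<open>
  Expansion of the part of a word that follows its letter number \<open>s\<close>, where that letter plays the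
  role of the constant \<open>a\<close> of an expansion over the constants \<open>0, \<dots>, a\<close>.
\<close>

definition expand_after :: "nat \<Rightarrow> nat \<Rightarrow> (nat list \<Rightarrow> nat list) \<Rightarrow> nat list \<Rightarrow> nat list" where
  "expand_after a s \<Psi> g =
     (if length g \<le> s then g
      else take (Suc s) g @
        map (\<lambda>v. if v < a then v else if v = a then g ! s else v - 1)
          (\<Psi> (map (\<lambda>v. if v < a then v else Suc v) (drop (Suc s) g))))"

lemma expand_after_short: "length g \<le> s \<Longrightarrow> expand_after a s \<Psi> g = g"
  by (simp add: expand_after_def)

lemma expand_after_append:
  assumes "length w = s"
  shows "expand_after a s \<Psi> (w @ y # t) = w @ y #
     map (\<lambda>v. if v < a then v else if v = a then y else v - 1)
          (\<Psi> (map (\<lambda>v. if v < a then v else Suc v) t))"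
  using assms by (auto simp: expand_after_def)

lemma long_list_split:
  assumes "\<not> length g \<le> s"
  obtains w y t where "g = w @ y # t" "length w = s"
  using assms id_take_nth_drop[of s g] that[of "take s g" "g ! s" "drop (Suc s) g"] by simp

text \<open>\<open>up\<close> frees the letter \<open>a\<close> for use as a constant of
  \<open>\<Psi>\<close>, and \<open>down y\<close> then reads that constant as \<open>y\<close>, the
  letter number \<open>s\<close>. Since \<open>y\<close> has been seen before the tail starts, its
  copies in the tail create no first appearance.\<close>

lemma expansion_expand_after:
  assumes \<Psi>: "expansion (Suc a) \<Psi>"
  shows "expansion a (expand_after a s \<Psi>)"
proof -
  define up where "up v = (if v < a then v else Suc v)" for v
  define down where "down y v = (if v < a then v else if v = a then y else v - 1)" for y v
  have down_up: "down y (up v) = v" for y v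
    by (simp add: up_def down_def)
  have app: "expand_after a s \<Psi> (w @ y # t) = w @ y # map (down y) (\<Psi> (map up t))"
    if "length w = s" for w y t
    using expand_after_append[OF that, of a \<Psi> y t] by (simp add: up_def[abs_def] down_def[abs_def])
  show ?thesis
    unfolding expansion_def
  proof (intro conjI allI impI)
    show "expand_after a s \<Psi> (map \<sigma> g) = map \<sigma> (expand_after a s \<Psi> g)"
      if \<sigma>: "\<forall>v<a. \<sigma> v = v" for \<sigma> g
    proof (cases "length g \<le> s")
      case True
      then show ?thesis by (simp add: expand_after_short)
    next
      case False
      then obtain w y t where g: "g = w @ y # t" "length w = s"
        by (rule long_list_split)
      \<comment> \<open>The relabelling \<open>\<sigma>\<close> carried through the shift. It fixes
        the constants \<open>0, ..., a\<close> of \<open>\<Psi>\<close>; that \<open>y\<close>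
        becomes \<open>\<sigma> y\<close> is left to \<open>down\<close>.\<close>
      define \<tau> where "\<tau> v = (if v \<le> a then v else up (\<sigma> (v - 1)))" for v
      have "map up (map \<sigma> t) = map \<tau> (map up t)"
        using \<sigma> by (auto simp: up_def \<tau>_def)
      then have "\<Psi> (map up (map \<sigma> t)) = map \<tau> (\<Psi> (map up t))"
        by (simp only:) (rule expansionD(1)[OF \<Psi>], simp add: \<tau>_def)
      moreover have "down (\<sigma> y) (\<tau> v) = \<sigma> (down y v)" for v
        using \<sigma> by (cases "v \<le> a") (auto simp: \<tau>_def down_up, auto simp: down_def)
      ultimately have "map (down (\<sigma> y)) (\<Psi> (map up (map \<sigma> t))) = map \<sigma> (map (down y) (\<Psi> (map up t)))"
        by simp
      then show ?thesis
        using g app[of "map \<sigma> w" "\<sigma> y" "map \<sigma> t"] app[of w y t] by simp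
    qed
    show "seen_before a (expand_after a s \<Psi> g) v = seen_before a g v" if "a \<le> v" for g v
    proof (cases "length g \<le> s")
      case True
      then show ?thesis by (simp add: expand_after_short)
    next
      case False
      then obtain w y t where g: "g = w @ y # t" "length w = s"
        by (rule long_list_split)
      define z where "z = \<Psi> (map up t)"
      have "insert y (seen_before a (map (down y) z) v) = insert y (seen_before a t v)" if "v \<noteq> y"
      proof -
        have down: "down y x \<noteq> v \<longleftrightarrow> x \<noteq> Suc v" for x
          using \<open>a \<le> v\<close> \<open>v \<noteq> y\<close> by (auto simp: down_def)
        have up: "up x \<noteq> Suc v \<longleftrightarrow> x \<noteq> v" for x
          using \<open>a \<le> v\<close> by (auto simp: up_def)
        have down_image: "down y ` {..<Suc a} = insert y {..<a}"
          by (auto simp: down_def lessThan_Suc image_iff)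
        have "insert y (seen_before a (map (down y) z) v) =
            down y ` seen_before (Suc a) z (Suc v)"
          unfolding seen_before_def image_Un down_image
          by (simp add: takeWhile_map comp_def down image_image)
        also have "\<dots> = down y ` seen_before (Suc a) (map up t) (Suc v)"
          using expansionD(2)[OF \<Psi>, of "Suc v" "map up t"] \<open>a \<le> v\<close> by (simp add: z_def)
        also have "\<dots> = insert y (seen_before a t v)"
          unfolding seen_before_def image_Un down_image
          by (simp add: takeWhile_map comp_def up image_image down_up)
        finally show ?thesis .
      qed
      then show ?thesis
        using g app[of w y t] by (auto simp: seen_before_append seen_before_Cons z_def)
    qed
    show "\<exists>t'. expand_after a s \<Psi> (g @ y # t) = expand_after a s \<Psi> g @ y # t'"
      if y: "a \<le> y" "y \<notin> set g" for g y t
    proof (cases "length g \<le> s")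
      \<comment> \<open>The letter \<open>y\<close> stands at position
        \<open>length g \<le> s\<close> and so belongs to the unchanged part
        \<open>take (Suc s)\<close>.\<close>
      case True
      then show ?thesis
        by (auto simp: expand_after_def take_Cons' split: if_splits)
    next
      case False
      then obtain w x u where g: "g = w @ x # u" "length w = s"
        by (rule long_list_split)
      have "Suc y \<notin> set (map up u)"
        using y g by (auto simp: up_def split: if_splits)
      then obtain t' where "\<Psi> (map up u @ Suc y # map up t) = \<Psi> (map up u) @ Suc y # t'"
        using expansionD(3)[OF \<Psi>, of "Suc y" "map up u" "map up t"] y by auto
      moreover have "up y = Suc y" "down x (Suc y) = y"
        using y by (auto simp: up_def down_def)
      ultimately show ?thesis
        using g app[of w x "u @ y # t"] app[of w x u] by simp
    qed
  qed
qed

text \<open>For \<open>y = a\<close> the map back from the shifted letters fixes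
  \<open>0, ..., a\<close>, so it commutes with \<open>\<Psi>\<close> and cancels against the
  shift.\<close>

lemma expand_after_constant:
  assumes \<Psi>: "expansion (Suc a) \<Psi>" and "length w = s"
  shows "expand_after a s \<Psi> (w @ a # t) = w @ a # \<Psi> t"
proof -
  have "map (\<lambda>v. if v < a then v else if v = a then a else v - 1)
          (\<Psi> (map (\<lambda>v. if v < a then v else Suc v) t)) =
        \<Psi> (map (\<lambda>v. if v < a then v else if v = a then a else v - 1)
          (map (\<lambda>v. if v < a then v else Suc v) t))"
    by (rule expansionD(1)[OF \<Psi>, symmetric]) auto
  also have "map (\<lambda>v. if v < a then v else if v = a then a else v - 1)
          (map (\<lambda>v. if v < a then v else Suc v) t) = t"
    by (auto intro: map_idI)
  finally show ?thesis
    by (simp add: expand_after_append[OF assms(2)])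
qed

lemma length_expand_after:
  assumes "\<And>t. length t \<le> M \<Longrightarrow> length (\<Psi> t) \<le> n" "length g \<le> M"
  shows "length (expand_after a s \<Psi> g) \<le> s + 1 + n"
  using assms(1)[of "map (\<lambda>v. if v < a then v else Suc v) (drop (Suc s) g)"] assms(2)
  by (auto simp: expand_after_def)

text \<open>
  In a rigid word \<open>w @ a # t\<close> the tail \<open>t\<close> is rigid over one more constant. Expanding the tails
  behind the prefixes \<open>w\<close> of length \<open>0, 1, 2, \<dots>\<close> in turn makes the colour depend on \<open>w\<close> only.
\<close>

lemma expansion_colour_by_prefix:
  assumes IH: "dual_ramsey (Suc a) b"
  shows "\<forall>M. \<exists>n. \<forall>c :: nat list \<Rightarrow> nat. (\<forall>x. c x < r) \<longrightarrow>
     (\<exists>\<Phi>. expansion a \<Phi> \<and> (\<forall>g. length g \<le> M \<longrightarrow> length (\<Phi> g) \<le> n) \<and>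
        (\<forall>w t t'. set w \<subseteq> {..<a} \<longrightarrow> length w < s \<longrightarrow> rigid (Suc a) b t \<longrightarrow> rigid (Suc a) b t' \<longrightarrow>
           length (w @ a # t) \<le> M \<longrightarrow> length (w @ a # t') \<le> M \<longrightarrow>
           c (\<Phi> (w @ a # t)) = c (\<Phi> (w @ a # t'))))"
proof (induction s)
  case 0
  show ?case
    by (intro allI, rule_tac x = M in exI, intro allI impI exI[of _ "\<lambda>g. g"])
      (simp add: expansion_id)
next
  case (Suc s)
  let ?good = "\<lambda>M n s (c :: nat list \<Rightarrow> nat) \<Phi>.
        expansion a \<Phi> \<and> (\<forall>g. length g \<le> M \<longrightarrow> length (\<Phi> g) \<le> n) \<and>
        (\<forall>w t t'. set w \<subseteq> {..<a} \<longrightarrow> length w < s \<longrightarrow> rigid (Suc a) b t \<longrightarrow> rigid (Suc a) b t' \<longrightarrow>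
           length (w @ a # t) \<le> M \<longrightarrow> length (w @ a # t') \<le> M \<longrightarrow>
           c (\<Phi> (w @ a # t)) = c (\<Phi> (w @ a # t')))"
  show ?case
  proof
    fix M
    let ?C = "{w :: nat list. set w \<subseteq> {..<a} \<and> length w \<le> s}"
    obtain R :: nat where R: "\<And>c :: nat list \<Rightarrow> nat list \<Rightarrow> nat. (\<forall>w y. c w y < r) \<Longrightarrow>
      (\<exists>d. (\<forall>y. d y < R) \<and> (\<forall>y y'. d y = d y' \<longrightarrow> (\<forall>w\<in>?C. c w y = c w y')))"
      using product_colouring[OF finite_short_words[of a s], of r] by blast
    obtain n1 where n1: "\<And>d :: nat list \<Rightarrow> nat. (\<forall>x. d x < R) \<Longrightarrow>
      (\<exists>\<Psi>. expansion (Suc a) \<Psi> \<and> (\<forall>g. length g \<le> M \<longrightarrow> length (\<Psi> g) \<le> n1) \<and>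
        (\<forall>g g'. rigid (Suc a) b g \<longrightarrow> rigid (Suc a) b g' \<longrightarrow> length g \<le> M \<longrightarrow> length g' \<le> M \<longrightarrow>
           d (\<Psi> g) = d (\<Psi> g')))"
      using IH unfolding dual_ramsey_def by blast
    \<comment> \<open>The words have length up to \<open>s + 1 + n1\<close> once their tails are
      expanded, so the induction hypothesis is used with this bound in place of \<open>M\<close>;
      hence the quantifier over \<open>M\<close> inside the induction.\<close>
    obtain n where n: "\<And>c :: nat list \<Rightarrow> nat. (\<forall>x. c x < r) \<Longrightarrow> \<exists>\<Phi>. ?good (s + 1 + n1) n s c \<Phi>"
      using spec[OF Suc.IH, of "s + 1 + n1"] by blast
    have "\<exists>\<Phi>. ?good M n (Suc s) c \<Phi>" if c: "\<forall>x. c x < r" for c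
    proof -
      obtain \<Phi> where \<Phi>: "expansion a \<Phi>" "\<And>g. length g \<le> s + 1 + n1 \<Longrightarrow> length (\<Phi> g) \<le> n"
        "\<And>w t t'. set w \<subseteq> {..<a} \<Longrightarrow> length w < s \<Longrightarrow> rigid (Suc a) b t \<Longrightarrow> rigid (Suc a) b t' \<Longrightarrow>
           length (w @ a # t) \<le> s + 1 + n1 \<Longrightarrow> length (w @ a # t') \<le> s + 1 + n1 \<Longrightarrow>
           c (\<Phi> (w @ a # t)) = c (\<Phi> (w @ a # t'))"
        using n[OF c] by (elim exE conjE) blast
      have "\<exists>d. (\<forall>y. d y < R) \<and>
          (\<forall>y y'. d y = d y' \<longrightarrow> (\<forall>w\<in>?C. c (\<Phi> (w @ a # y)) = c (\<Phi> (w @ a # y'))))"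
        by (rule R) (use c in simp)
      then obtain d where d: "\<forall>y. d y < R"
        "\<And>y y' w. d y = d y' \<Longrightarrow> w \<in> ?C \<Longrightarrow> c (\<Phi> (w @ a # y)) = c (\<Phi> (w @ a # y'))"
        by (elim exE conjE) blast
      obtain \<Psi> where \<Psi>: "expansion (Suc a) \<Psi>" "\<And>g. length g \<le> M \<Longrightarrow> length (\<Psi> g) \<le> n1"
        "\<And>g g'. rigid (Suc a) b g \<Longrightarrow> rigid (Suc a) b g' \<Longrightarrow> length g \<le> M \<Longrightarrow> length g' \<le> M \<Longrightarrow>
           d (\<Psi> g) = d (\<Psi> g')"
        using n1[OF d(1)] by (elim exE conjE) blast
      let ?E = "expand_after a s \<Psi>"
      have E: "expansion a ?E"
        by (rule expansion_expand_after[OF \<Psi>(1)])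
      have length_E: "length (?E g) \<le> s + 1 + n1" if "length g \<le> M" for g
        using length_expand_after[OF \<Psi>(2) that] by simp
      have "c (\<Phi> (?E (w @ a # t))) = c (\<Phi> (?E (w @ a # t')))"
        if w: "set w \<subseteq> {..<a}" "length w < Suc s"
          and t: "rigid (Suc a) b t" "rigid (Suc a) b t'"
          and M: "length (w @ a # t) \<le> M" "length (w @ a # t') \<le> M" for w t t'
      proof (cases "length w = s")
        case True
        have "d (\<Psi> t) = d (\<Psi> t')"
          by (rule \<Psi>(3)) (use t M in auto)
        then have "c (\<Phi> (w @ a # \<Psi> t)) = c (\<Phi> (w @ a # \<Psi> t'))"
          by (rule d(2)) (use w True in auto)
        then show ?thesis
          using True by (simp add: expand_after_constant[OF \<Psi>(1)])
      next
        case False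
        \<comment> \<open>\<open>?E\<close> leaves a prefix shorter than \<open>s\<close> and the
          \<open>a\<close> behind it alone; it only exchanges one rigid tail for another, so the
          property of \<open>\<Phi>\<close> for shorter prefixes still applies.\<close>
        have *: "\<exists>u'. ?E (w @ a # u) = w @ a # u' \<and> rigid (Suc a) b u'"
          if "rigid (Suc a) b u" "length (w @ a # u) \<le> M" for u
        proof -
          have "a < b"
            using t(1) by (simp add: rigid_def)
          obtain u' where u': "?E (w @ a # u) = ?E w @ a # u'"
            using expansionD(3)[OF E, of a w u] w by auto
          moreover have "?E w = w"
            using w by (simp add: expand_after_short)
          moreover have "rigid a b (?E (w @ a # u))"
            using that w \<open>a < b\<close> by (intro rigid_expansion[OF E]) (simp add: rigid_append_Cons_iff)
          ultimately show ?thesis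
            using w rigid_append_Cons_iff by auto
        qed
        obtain u where u: "?E (w @ a # t) = w @ a # u" "rigid (Suc a) b u"
          using * t M by blast
        obtain u' where u': "?E (w @ a # t') = w @ a # u'" "rigid (Suc a) b u'"
          using * t M by blast
        have "length (w @ a # u) \<le> s + 1 + n1" "length (w @ a # u') \<le> s + 1 + n1"
          using length_E[OF M(1)] length_E[OF M(2)] by (simp_all only: u u')
        then show ?thesis
          unfolding u u' using u(2) u'(2) False w by (intro \<Phi>(3)) auto
      qed
      moreover have "expansion a (\<lambda>g. \<Phi> (?E g))"
        by (rule expansion_comp[OF \<Phi>(1) E])
      moreover have "length (\<Phi> (?E g)) \<le> n" if "length g \<le> M" for g
        using \<Phi>(2) length_E[OF that] by blast
      ultimately show ?thesis
        by (intro exI[of _ "\<lambda>g. \<Phi> (?E g)"]) blast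
    qed
    then show "\<exists>n. \<forall>c. (\<forall>x. c x < r) \<longrightarrow> (\<exists>\<Phi>. ?good M n (Suc s) c \<Phi>)"
      by blast
  qed
qed

text \<open>\<open>\<Phi>\<close> makes the colour of \<open>w @ a # t\<close> depend on
  \<open>w\<close> only, and the reference tail \<open>[Suc a..<b]\<close> turns it into a colouring
  \<open>c1\<close> of constant words, for which \<open>\<Theta>\<close> is chosen. In the
  composition \<open>\<Theta>\<close> acts first, so its bound \<open>m\<close> is obtained first;
  \<open>m + b\<close> leaves room for the reference tail.\<close>

lemma dual_ramsey_step:
  assumes IH: "dual_ramsey (Suc a) b" and "a < b"
  shows "dual_ramsey a b"
  unfolding dual_ramsey_def
proof (intro allI)
  fix r M
  let ?goal = "\<lambda>n (c :: nat list \<Rightarrow> nat) \<Phi>. expansion a \<Phi> \<and> (\<forall>g. length g \<le> M \<longrightarrow> length (\<Phi> g) \<le> n) \<and>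
        (\<forall>g g'. rigid a b g \<longrightarrow> rigid a b g' \<longrightarrow> length g \<le> M \<longrightarrow> length g' \<le> M \<longrightarrow>
           c (\<Phi> g) = c (\<Phi> g'))"
  obtain m where m: "\<And>c :: nat list \<Rightarrow> nat. (\<forall>x. c x < r) \<Longrightarrow>
     \<exists>\<Theta>. expansion a \<Theta> \<and> (\<forall>g. length g \<le> M \<longrightarrow> length (\<Theta> g) \<le> m) \<and>
        (\<forall>g g'. rigid a a g \<longrightarrow> rigid a a g' \<longrightarrow> length g \<le> M \<longrightarrow> length g' \<le> M \<longrightarrow>
           c (\<Theta> g) = c (\<Theta> g'))"
    using spec[OF spec[OF dual_ramsey_constant_words[of a, unfolded dual_ramsey_def], of r], of M]
    by blast
  obtain n where n: "\<And>c :: nat list \<Rightarrow> nat. (\<forall>x. c x < r) \<Longrightarrow>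
     \<exists>\<Phi>. expansion a \<Phi> \<and> (\<forall>g. length g \<le> m + b \<longrightarrow> length (\<Phi> g) \<le> n) \<and>
        (\<forall>w t t'. set w \<subseteq> {..<a} \<longrightarrow> length w < m \<longrightarrow> rigid (Suc a) b t \<longrightarrow> rigid (Suc a) b t' \<longrightarrow>
           length (w @ a # t) \<le> m + b \<longrightarrow> length (w @ a # t') \<le> m + b \<longrightarrow>
           c (\<Phi> (w @ a # t)) = c (\<Phi> (w @ a # t')))"
    using spec[OF expansion_colour_by_prefix[OF IH, of r m], of "m + b"] by blast
  have "\<exists>\<Phi>. ?goal n c \<Phi>" if c: "\<forall>x. c x < r" for c
  proof -
    obtain \<Phi> where \<Phi>: "expansion a \<Phi>" "\<And>g. length g \<le> m + b \<Longrightarrow> length (\<Phi> g) \<le> n"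
      "\<And>w t t'. set w \<subseteq> {..<a} \<Longrightarrow> length w < m \<Longrightarrow> rigid (Suc a) b t \<Longrightarrow> rigid (Suc a) b t' \<Longrightarrow>
           length (w @ a # t) \<le> m + b \<Longrightarrow> length (w @ a # t') \<le> m + b \<Longrightarrow>
           c (\<Phi> (w @ a # t)) = c (\<Phi> (w @ a # t'))"
      using n[OF c] by (elim exE conjE) blast
    define c1 where "c1 w = c (\<Phi> (w @ a # [Suc a..<b]))" for w
    have "\<forall>w. c1 w < r"
      using c by (simp add: c1_def)
    from m[OF this] obtain \<Theta> where \<Theta>: "expansion a \<Theta>" "\<And>g. length g \<le> M \<Longrightarrow> length (\<Theta> g) \<le> m"
      "\<And>g g'. rigid a a g \<Longrightarrow> rigid a a g' \<Longrightarrow> length g \<le> M \<Longrightarrow> length g' \<le> M \<Longrightarrow>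
           c1 (\<Theta> g) = c1 (\<Theta> g')"
      by (elim exE conjE) blast
    have colour: "\<exists>w. rigid a a w \<and> length w \<le> M \<and> c (\<Phi> (\<Theta> g)) = c1 (\<Theta> w)"
      if g: "rigid a b g" "length g \<le> M" for g
    proof -
      obtain w t where w: "g = w @ a # t" "set w \<subseteq> {..<a}" "rigid (Suc a) b t"
        using rigid_split[OF g(1) \<open>a < b\<close>] .
      \<comment> \<open>The last clause of \<open>expansion\<close> respects the cut: the part
        before the first \<open>a\<close> is expanded as if it stood alone.\<close>
      obtain t' where t': "\<Theta> g = \<Theta> w @ a # t'"
        using expansionD(3)[OF \<Theta>(1), of a w t] w by auto
      have \<Theta>w: "set (\<Theta> w) \<subseteq> {..<a}"
        using expansion_constant_words[OF \<Theta>(1) w(2)] .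
      have "rigid a b (\<Theta> g)"
        by (rule rigid_expansion[OF \<Theta>(1) g(1)])
      then have "rigid (Suc a) b t'"
        using t' rigid_append_Cons_iff[OF \<Theta>w] by simp
      moreover have "length (\<Theta> w @ a # t') \<le> m"
        using \<Theta>(2)[OF g(2)] t' by simp
      moreover have "rigid (Suc a) b [Suc a..<b]"
        using \<open>a < b\<close> by (intro rigid_upt) simp
      ultimately have "c (\<Phi> (\<Theta> g)) = c1 (\<Theta> w)"
        unfolding t' c1_def using \<Theta>w by (intro \<Phi>(3)) auto
      moreover have "rigid a a w" "length w \<le> M"
        using w g by (auto simp: rigid_self_iff)
      ultimately show ?thesis by blast
    qed
    have "c (\<Phi> (\<Theta> g)) = c (\<Phi> (\<Theta> g'))"
      if "rigid a b g" "rigid a b g'" "length g \<le> M" "length g' \<le> M" for g g'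
      using colour[of g] colour[of g'] that \<Theta>(3) by metis
    moreover have "expansion a (\<lambda>g. \<Phi> (\<Theta> g))"
      by (rule expansion_comp[OF \<Phi>(1) \<Theta>(1)])
    moreover have "length (\<Phi> (\<Theta> g)) \<le> n" if "length g \<le> M" for g
      using \<Theta>(2)[OF that] by (intro \<Phi>(2)) simp
    ultimately show ?thesis
      by (intro exI[of _ "\<lambda>g. \<Phi> (\<Theta> g)"]) blast
  qed
  then show "\<exists>n. \<forall>c. (\<forall>x. c x < r) \<longrightarrow> (\<exists>\<Phi>. ?goal n c \<Phi>)"
    by blast
qed

theorem dual_ramsey: "a \<le> b \<Longrightarrow> dual_ramsey a b"
proof (induction "b - a" arbitrary: a)
  case 0
  then have "a = b"
    by simp
  then show ?case
    using dual_ramsey_constant_words by blast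
next
  case (Suc d)
  have "d = b - Suc a" "Suc a \<le> b"
    using Suc.hyps(2) by auto
  then have "dual_ramsey (Suc a) b"
    by (rule Suc.hyps(1))
  then show ?case
    by (rule dual_ramsey_step) (use \<open>Suc a \<le> b\<close> in simp)
qed

corollary rigid_words_ramsey:
  "\<exists>n. \<forall>c :: nat list \<Rightarrow> nat. (\<forall>x. c x < r) \<longrightarrow>
     (\<exists>h. length h \<le> n \<and> set h = {..<M} \<and>
        (\<forall>g g'. rigid 0 b g \<longrightarrow> rigid 0 b g' \<longrightarrow> length g = M \<longrightarrow> length g' = M \<longrightarrow>
           c (map ((!) g) h) = c (map ((!) g') h)))"
proof -
  obtain n where n: "\<And>c :: nat list \<Rightarrow> nat. (\<forall>x. c x < r) \<Longrightarrow>
     \<exists>\<Phi>. expansion 0 \<Phi> \<and> (\<forall>g. length g \<le> M \<longrightarrow> length (\<Phi> g) \<le> n) \<and>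
        (\<forall>g g'. rigid 0 b g \<longrightarrow> rigid 0 b g' \<longrightarrow> length g \<le> M \<longrightarrow> length g' \<le> M \<longrightarrow>
           c (\<Phi> g) = c (\<Phi> g'))"
    using spec[OF spec[OF dual_ramsey[of 0 b, unfolded dual_ramsey_def, OF le0], of r], of M]
    by blast
  have "\<exists>h. length h \<le> n \<and> set h = {..<M} \<and>
        (\<forall>g g'. rigid 0 b g \<longrightarrow> rigid 0 b g' \<longrightarrow> length g = M \<longrightarrow> length g' = M \<longrightarrow>
           c (map ((!) g) h) = c (map ((!) g') h))" if c: "\<forall>x. c x < r" for c :: "nat list \<Rightarrow> nat"
  proof -
    obtain \<Phi> where \<Phi>: "expansion 0 \<Phi>" "\<And>g. length g \<le> M \<Longrightarrow> length (\<Phi> g) \<le> n"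
      "\<And>g g'. rigid 0 b g \<Longrightarrow> rigid 0 b g' \<Longrightarrow> length g \<le> M \<Longrightarrow> length g' \<le> M \<Longrightarrow>
           c (\<Phi> g) = c (\<Phi> g')"
      using n[OF c] by (elim exE conjE) blast
    \<comment> \<open>Without constants every relabelling commutes with \<open>\<Phi>\<close>, in
      particular \<open>(!) g\<close>, so on words of length \<open>M\<close> the map
      \<open>\<Phi>\<close> is substitution into the single word
      \<open>\<Phi> [0..<M]\<close>.\<close>
    have "map ((!) g) (\<Phi> [0..<M]) = \<Phi> g" if "length g = M" for g
      using expansionD(1)[OF \<Phi>(1), of "(!) g" "[0..<M]"] that map_nth[of g] by simp
    then have "c (map ((!) g) (\<Phi> [0..<M])) = c (map ((!) g') (\<Phi> [0..<M]))"
      if "rigid 0 b g" "rigid 0 b g'" "length g = M" "length g' = M" for g g'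
      using \<Phi>(3)[of g g'] that by simp
    moreover have "set (\<Phi> [0..<M]) = {..<M}"
      using expansion_set[OF \<Phi>(1), of "[0..<M]"] by (simp add: atLeast0LessThan)
    moreover have "length (\<Phi> [0..<M]) \<le> n"
      by (rule \<Phi>(2)) simp
    ultimately show ?thesis
      by blast
  qed
  then show ?thesis by blast
qed

section \<open>Enumerating up-sets lexicographically\<close>

text \<open>A binary number with smaller ranks as more significant digits, so that for subsets of
  \<open>{..n}\<close> comparing weights is comparing lexicographically.\<close>

definition lex_weight :: "nat \<Rightarrow> nat set \<Rightarrow> nat" where
  "lex_weight n R = (\<Sum>r\<in>R. 2 ^ (n - r))"

lemma lex_weight_less:
  assumes R: "R \<subseteq> {..n}" "R' \<subseteq> {..n}" and \<rho>: "\<rho> \<in> R'" "\<rho> \<notin> R"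
    and below: "\<And>r. r < \<rho> \<Longrightarrow> r \<in> R \<Longrightarrow> r \<in> R'"
  shows "lex_weight n R < lex_weight n R'"
proof -
  let ?w = "\<lambda>A. \<Sum>r\<in>A. (2 :: nat) ^ (n - r)"
  have fin: "finite R" "finite R'"
    using R finite_subset by blast+
  have "\<rho> \<le> n"
    using R \<rho> by auto
  have "R \<subseteq> (R' \<inter> {..<\<rho>}) \<union> {\<rho><..n}"
  proof
    fix r
    assume "r \<in> R"
    then show "r \<in> (R' \<inter> {..<\<rho>}) \<union> {\<rho><..n}"
      using \<rho> below[of r] R by (cases r \<rho> rule: linorder_cases) auto
  qed
  then have "?w R \<le> ?w ((R' \<inter> {..<\<rho>}) \<union> {\<rho><..n})"
    using fin by (intro sum_mono2) auto
  also have "\<dots> = ?w (R' \<inter> {..<\<rho>}) + ?w {\<rho><..n}"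
    using fin by (intro sum.union_disjoint) auto
  also have "?w {\<rho><..n} = (\<Sum>i<n - \<rho>. 2 ^ i)"
    by (rule sum.reindex_bij_witness[of _ "\<lambda>i. n - i" "\<lambda>r. n - r"]) (use \<open>\<rho> \<le> n\<close> in auto)
  also have "\<dots> < 2 ^ (n - \<rho>)"
  proof -
    have "(\<Sum>i<j. (2 :: nat) ^ i) < 2 ^ j" for j
      by (induction j) auto
    then show ?thesis .
  qed
  also have "?w (R' \<inter> {..<\<rho>}) + 2 ^ (n - \<rho>) = ?w (insert \<rho> (R' \<inter> {..<\<rho>}))"
    using fin by (subst sum.insert) auto
  also have "\<dots> \<le> ?w R'"
    using fin \<rho> by (intro sum_mono2) auto
  finally show ?thesis
    by (simp add: lex_weight_def)
qed

definition up_sets :: "'a set \<Rightarrow> ('a \<Rightarrow> 'a \<Rightarrow> bool) \<Rightarrow> 'a set set" where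
  "up_sets Y p = {u. u \<subseteq> Y \<and> (\<forall>x\<in>u. \<forall>y\<in>Y. p x y \<longrightarrow> y \<in> u)}"

text \<open>The set that contains the first difference comes later, so a set never precedes its
  subsets. Hence the least up-set with a given restriction to a copy is also the earliest.\<close>

definition lex_less :: "'a set \<Rightarrow> ('a \<Rightarrow> nat) \<Rightarrow> 'a set \<Rightarrow> 'a set \<Rightarrow> bool" where
  "lex_less Y \<rho> u u' \<longleftrightarrow> (\<exists>x\<in>u' - u. \<forall>y\<in>Y. \<rho> y < \<rho> x \<longrightarrow> (y \<in> u \<longleftrightarrow> y \<in> u'))"

lemma lex_less_linear:
  fixes \<rho> :: "'a \<Rightarrow> nat"
  assumes "u \<subseteq> Y" "u' \<subseteq> Y" "u \<noteq> u'"
  shows "lex_less Y \<rho> u u' \<or> lex_less Y \<rho> u' u"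
proof -
  have "\<exists>x. x \<in> (u - u') \<union> (u' - u)"
    using assms by blast
  then obtain x where x: "x \<in> (u - u') \<union> (u' - u)"
    "\<And>y. y \<in> (u - u') \<union> (u' - u) \<Longrightarrow> \<rho> x \<le> \<rho> y"
    using ex_has_least_nat[of "\<lambda>x. x \<in> (u - u') \<union> (u' - u)" _ \<rho>] by blast
  have "y \<in> u \<longleftrightarrow> y \<in> u'" if "\<rho> y < \<rho> x" for y
    using x(2)[of y] that by auto
  then show ?thesis
    using x(1) unfolding lex_less_def by blast
qed

text \<open>Elements of equal rank are equivalent under \<open>p\<close>, so an up-set is determined
  by its ranks, and lexicographic comparison becomes comparison of the numbers
  \<open>lex_weight\<close>.\<close>

lemma enumerate_up_sets:
  fixes \<rho> :: "'a \<Rightarrow> nat"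
  assumes "finite Y" and \<rho>: "\<And>x y. x \<in> Y \<Longrightarrow> y \<in> Y \<Longrightarrow> \<rho> x = \<rho> y \<Longrightarrow> p x y"
  shows "\<exists>(m :: nat) en. bij_betw en {..<m} (up_sets Y p) \<and>
    (\<forall>i<m. \<forall>j<m. i < j \<longleftrightarrow> lex_less Y \<rho> (en i) (en j))"
proof -
  define U where "U = up_sets Y p"
  obtain n where n: "\<rho> ` Y \<subseteq> {..n}"
    using \<open>finite Y\<close> finite_nat_iff_bounded_le by blast
  define key where "key u = lex_weight n (\<rho> ` u)" for u
  have key_less: "key u < key u'" if u: "u \<in> U" "u' \<in> U" and less: "lex_less Y \<rho> u u'" for u u'
  proof -
    have sub: "u \<subseteq> Y" "u' \<subseteq> Y"
      using u by (auto simp: U_def up_sets_def)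
    obtain x where x: "x \<in> u'" "x \<notin> u" "\<And>y. y \<in> Y \<Longrightarrow> \<rho> y < \<rho> x \<Longrightarrow> y \<in> u \<longleftrightarrow> y \<in> u'"
      using less by (auto simp: lex_less_def)
    show ?thesis
      unfolding key_def
    proof (rule lex_weight_less)
      show "\<rho> ` u \<subseteq> {..n}" "\<rho> ` u' \<subseteq> {..n}"
        using n sub by blast+
      show "\<rho> x \<in> \<rho> ` u'"
        using x by blast
      show "\<rho> x \<notin> \<rho> ` u"
      proof
        assume "\<rho> x \<in> \<rho> ` u"
        then obtain y where "y \<in> u" "\<rho> y = \<rho> x"
          by (metis imageE)
        then have "p y x"
          using \<rho> sub x by blast
        then show False
          using \<open>y \<in> u\<close> u x sub by (auto simp: U_def up_sets_def)
      qed
      show "r \<in> \<rho> ` u'" if "r < \<rho> x" "r \<in> \<rho> ` u" for r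
        using that x(3) sub by blast
    qed
  qed
  have lex_iff: "key u < key u' \<longleftrightarrow> lex_less Y \<rho> u u'" if "u \<in> U" "u' \<in> U" for u u'
  proof
    assume "key u < key u'"
    then have "u \<noteq> u'" "\<not> lex_less Y \<rho> u' u"
      using key_less[of u' u] that by auto
    then show "lex_less Y \<rho> u u'"
      using lex_less_linear[of u Y u' \<rho>] that by (auto simp: U_def up_sets_def)
  qed (rule key_less[OF that])
  have inj: "inj_on key U"
  proof (rule inj_onI)
    fix u u'
    assume "u \<in> U" "u' \<in> U" "key u = key u'"
    then show "u = u'"
      using lex_less_linear[of u Y u' \<rho>] lex_iff[of u u'] lex_iff[of u' u]
      by (auto simp: U_def up_sets_def)
  qed
  have "U \<subseteq> Pow Y"
    by (auto simp: U_def up_sets_def)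
  then have "finite U"
    using \<open>finite Y\<close> finite_subset by blast
  then obtain e where e: "bij_betw e {..<card (key ` U)} (key ` U)"
    "strict_mono_on {..<card (key ` U)} e"
    using ex_bij_betw_strict_mono_card[of "key ` U"] by blast
  define en where "en = inv_into U key \<circ> e"
  have bij: "bij_betw en {..<card (key ` U)} U"
    unfolding en_def using e(1) inj by (intro bij_betw_trans bij_betw_inv_into) (auto simp: bij_betw_def)
  have key_en: "key (en i) = e i" if "i < card (key ` U)" for i
    using bij_betwE[OF e(1)] that by (auto simp: en_def f_inv_into_f)
  show ?thesis
  proof (intro exI conjI allI impI)
    show "bij_betw en {..<card (key ` U)} (up_sets Y p)"
      using bij by (simp add: U_def)
    fix i j
    assume ij: "i < card (key ` U)" "j < card (key ` U)"
    then have "lex_less Y \<rho> (en i) (en j) \<longleftrightarrow> e i < e j"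
      using lex_iff[of "en i" "en j"] key_en bij_betwE[OF bij] by auto
    also have "\<dots> \<longleftrightarrow> i < j"
      using strict_mono_on_less[OF e(2)] ij by simp
    finally show "i < j \<longleftrightarrow> lex_less Y \<rho> (en i) (en j)"
      by simp
  qed
qed

text \<open>Here \<open>q v\<close> is the position of the first appearance of \<open>v\<close>: by
  \<open>first\<close>, no letter of \<open>g\<close> occurs before its own
  \<open>q\<close>.\<close>

lemma rigidI:
  assumes "set g \<subseteq> {..<b}"
    and q: "\<And>v. v < b \<Longrightarrow> q v < length g \<and> g ! q v = v"
    and mono: "\<And>v w. v < w \<Longrightarrow> w < b \<Longrightarrow> q v < q w"
    and first: "\<And>j. j < length g \<Longrightarrow> q (g ! j) \<le> j"
  shows "rigid 0 b g"
proof -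
  have less_b: "g ! j < b" if "j < length g" for j
    using assms(1) that nth_mem by blast
  have "seen_before 0 g v = {..<min v b}" for v
  proof (cases "v < b")
    case True
    have "takeWhile (\<lambda>x. x \<noteq> v) g = take (q v) g"
    proof (rule takeWhile_eq_take_P_nth)
      show "g ! j \<noteq> v" if "j < q v" "j < length g" for j
        using first[OF that(2)] that by auto
      show "\<not> g ! q v \<noteq> v" if "q v < length g"
        using q True by simp
    qed
    moreover have "set (take (q v) g) = {..<v}"
    proof (intro equalityI subsetI)
      fix x
      assume "x \<in> set (take (q v) g)"
      then obtain j where j: "j < q v" "j < length g" "x = g ! j"
        by (auto simp: in_set_conv_nth)
      then have "q x < q v"
        using first[OF j(2)] by simp
      then show "x \<in> {..<v}"
        using mono[of v x] less_b[OF j(2)] j(3) by (cases v x rule: linorder_cases) auto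
    next
      fix x
      assume "x \<in> {..<v}"
      then have "q x < q v" "q x < length g" "g ! q x = x"
        using mono[of x v] q[of x] True by auto
      then have "take (q v) g ! q x = x" "q x < length (take (q v) g)"
        by simp_all
      then show "x \<in> set (take (q v) g)"
        by (metis nth_mem)
    qed
    ultimately show ?thesis
      using True by (simp add: seen_before_def)
  next
    case False
    then have "v \<notin> set g"
      using assms(1) by auto
    moreover have "set g = {..<b}"
    proof
      show "{..<b} \<subseteq> set g"
      proof
        fix v
        assume "v \<in> {..<b}"
        then show "v \<in> set g"
          using q[of v] nth_mem[of "q v" g] by simp
      qed
    qed (rule assms(1))
    ultimately show ?thesis
      using False by (simp add: seen_before_notin)
  qed
  then show ?thesis
    by (simp add: rigid_def)
qed

text \<open>
  The letter sets \<open>D v\<close> are the up-sets of one copy, the positions are the up-sets of all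
  copies together, and \<open>row i\<close> restricts the latter to the copy \<open>i\<close>. A fixed up-set \<open>u\<close> of the
  copy \<open>i\<close> makes its first appearance at the up-set generated by \<open>u \<times> {i}\<close>, and this
  generation preserves the lexicographic order; so all rows are rigid.
\<close>

lemma rigid_rows:
  fixes S :: "'s set" and pre :: "'s \<times> nat \<Rightarrow> 's \<times> nat \<Rightarrow> bool" and rk :: "'s \<times> nat \<Rightarrow> nat" and k :: nat
  defines "X \<equiv> S \<times> {1..k}"
  assumes "finite S" "1 \<le> k"
    and refl: "\<And>x. x \<in> X \<Longrightarrow> pre x x"
    and trans: "\<And>x y z. x \<in> X \<Longrightarrow> y \<in> X \<Longrightarrow> z \<in> X \<Longrightarrow> pre x y \<Longrightarrow> pre y z \<Longrightarrow> pre x z"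
    and pre_rk: "\<And>x y. x \<in> X \<Longrightarrow> y \<in> X \<Longrightarrow> pre x y \<Longrightarrow> rk x \<le> rk y"
    and rk_pre: "\<And>x y. x \<in> X \<Longrightarrow> y \<in> X \<Longrightarrow> rk x = rk y \<Longrightarrow> pre x y"
    and pre_copy: "\<And>s t i j. s \<in> S \<Longrightarrow> t \<in> S \<Longrightarrow> i \<in> {1..k} \<Longrightarrow> j \<in> {1..k} \<Longrightarrow>
      pre (s, i) (t, i) \<longleftrightarrow> pre (s, j) (t, j)"
    and rk_copy: "\<And>s t i j. s \<in> S \<Longrightarrow> t \<in> S \<Longrightarrow> i \<in> {1..k} \<Longrightarrow> j \<in> {1..k} \<Longrightarrow>
      rk (s, i) \<le> rk (t, i) \<longleftrightarrow> rk (s, j) \<le> rk (t, j)"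
  shows "\<exists>b m (D :: nat \<Rightarrow> 's set) row.
      (\<forall>i\<in>{1..k}. rigid 0 b (row i) \<and> length (row i) = m) \<and>
      (\<forall>s\<in>S. \<forall>t\<in>S. \<forall>i\<in>{1..k}. \<forall>j\<in>{1..k}. pre (s, i) (t, j) \<longrightarrow>
        (\<forall>l<m. s \<in> D (row i ! l) \<longrightarrow> t \<in> D (row j ! l))) \<and>
      (\<forall>s\<in>S. \<exists>v<b. D v = {t \<in> S. pre (s, 1) (t, 1)})"
proof -
  have one: "1 \<in> {1..k}"
    using \<open>1 \<le> k\<close> by simp
  define preS where "preS s t = pre (s, 1) (t, 1)" for s t
  define rkS where "rkS s = rk (s, 1)" for s
  have preS: "pre (s, i) (t, i) \<longleftrightarrow> preS s t" if "s \<in> S" "t \<in> S" "i \<in> {1..k}" for s t i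
    using pre_copy[OF that one] by (simp add: preS_def)
  have rkS: "rk (s, i) < rk (t, i) \<longleftrightarrow> rkS s < rkS t" if "s \<in> S" "t \<in> S" "i \<in> {1..k}" for s t i
    using rk_copy[OF that(2,1,3) one] by (simp add: rkS_def not_le[symmetric])
  have rkS_pre: "preS s t" if "s \<in> S" "t \<in> S" "rkS s = rkS t" for s t
    using rk_pre[of "(s, 1)" "(t, 1)"] that one by (simp add: preS_def rkS_def X_def)
  have "\<exists>(b :: nat) D. bij_betw D {..<b} (up_sets S preS) \<and>
      (\<forall>i<b. \<forall>j<b. i < j \<longleftrightarrow> lex_less S rkS (D i) (D j))"
    using \<open>finite S\<close> rkS_pre by (rule enumerate_up_sets)
  then obtain b :: nat and D where D: "bij_betw D {..<b} (up_sets S preS)"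
    "\<And>i j. i < b \<Longrightarrow> j < b \<Longrightarrow> i < j \<longleftrightarrow> lex_less S rkS (D i) (D j)"
    by blast
  have "finite X"
    using \<open>finite S\<close> by (simp add: X_def)
  then have "\<exists>(m :: nat) Z. bij_betw Z {..<m} (up_sets X pre) \<and>
      (\<forall>i<m. \<forall>j<m. i < j \<longleftrightarrow> lex_less X rk (Z i) (Z j))"
    using rk_pre by (rule enumerate_up_sets)
  then obtain m :: nat and Z where Z: "bij_betw Z {..<m} (up_sets X pre)"
    "\<And>i j. i < m \<Longrightarrow> j < m \<Longrightarrow> i < j \<longleftrightarrow> lex_less X rk (Z i) (Z j)"
    by blast
  define restr where "restr i z = {s \<in> S. (s, i) \<in> z}" for i :: nat and z
  define up where "up i u = {x \<in> X. \<exists>s\<in>u. pre (s, i) x}" for i u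
  have restr: "restr i z \<in> up_sets S preS" if z: "z \<in> up_sets X pre" and i: "i \<in> {1..k}" for i z
    using z preS[OF _ _ i] i unfolding up_sets_def restr_def X_def by auto
  have up: "up i u \<in> up_sets X pre" if "u \<in> up_sets S preS" "i \<in> {1..k}" for i u
  proof -
    have "\<exists>s\<in>u. pre (s, i) y" if "s \<in> u" "pre (s, i) x" "x \<in> X" "y \<in> X" "pre x y" for s x y
      using trans[of "(s, i)" x y] that \<open>u \<in> up_sets S preS\<close> \<open>i \<in> {1..k}\<close>
      by (auto simp: up_sets_def X_def)
    then show ?thesis
      by (auto simp: up_sets_def up_def)
  qed
  have restr_up: "restr i (up i u) = u" if "u \<in> up_sets S preS" "i \<in> {1..k}" for i u
  proof -
    have "u \<subseteq> S"
      using that by (auto simp: up_sets_def)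
    show ?thesis
    proof (intro equalityI subsetI)
      fix t
      assume "t \<in> restr i (up i u)"
      then obtain s where s: "t \<in> S" "s \<in> u" "pre (s, i) (t, i)"
        by (auto simp: restr_def up_def)
      then have "preS s t"
        using preS[of s t i] \<open>u \<subseteq> S\<close> that(2) by blast
      then show "t \<in> u"
        using s that(1) by (simp add: up_sets_def)
    next
      fix t
      assume "t \<in> u"
      moreover have "(t, i) \<in> X"
        using \<open>t \<in> u\<close> \<open>u \<subseteq> S\<close> that(2) by (auto simp: X_def)
      ultimately show "t \<in> restr i (up i u)"
        using refl[of "(t, i)"] \<open>u \<subseteq> S\<close> unfolding restr_def up_def by blast
    qed
  qed
  have up_restr: "up i (restr i z) \<subseteq> z" if "z \<in> up_sets X pre" for i z
    using that unfolding up_def restr_def up_sets_def by blast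
  have up_lex: "lex_less X rk (up i u) (up i u')"
    if u: "u \<in> up_sets S preS" "u' \<in> up_sets S preS" and i: "i \<in> {1..k}"
      and less: "lex_less S rkS u u'" for i u u'
  proof -
    obtain x where x: "x \<in> u'" "x \<notin> u" "\<And>y. y \<in> S \<Longrightarrow> rkS y < rkS x \<Longrightarrow> y \<in> u \<longleftrightarrow> y \<in> u'"
      using less by (auto simp: lex_less_def)
    have sub: "u \<subseteq> S" "u' \<subseteq> S"
      using u by (auto simp: up_sets_def)
    have xX: "(x, i) \<in> X"
      using x(1) sub i by (auto simp: X_def)
    have "(x, i) \<in> up i u'"
      using x(1) refl xX by (auto simp: up_def)
    moreover have "(x, i) \<notin> up i u"
      using restr_up[OF u(1) i] x(1,2) sub by (auto simp: restr_def)
    \<comment> \<open>Whether \<open>y\<close> is in \<open>up i u\<close> is decided by the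
      elements of \<open>u\<close> below \<open>y\<close>; their ranks are less than that of
      \<open>(x, i)\<close>, where \<open>u\<close> and \<open>u'\<close> agree.\<close>
    moreover have "y \<in> up i u \<longleftrightarrow> y \<in> up i u'" if y: "y \<in> X" "rk y < rk (x, i)" for y
    proof -
      have "s \<in> u \<longleftrightarrow> s \<in> u'" if "s \<in> S" "pre (s, i) y" for s
      proof -
        have "rk (s, i) < rk (x, i)"
          using pre_rk[of "(s, i)" y] that y i by (auto simp: X_def)
        then show ?thesis
          using x(3) rkS[of s x i] that x(1) sub i by auto
      qed
      then show ?thesis
        using sub by (auto simp: up_def)
    qed
    ultimately show ?thesis
      unfolding lex_less_def by blast
  qed
  define letter where "letter u = inv_into {..<b} D u" for u
  have letter: "letter u < b" "D (letter u) = u" if "u \<in> up_sets S preS" for u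
    using that D(1) inv_into_into[of u D "{..<b}"] f_inv_into_f[of u D "{..<b}"]
    by (auto simp: letter_def bij_betw_def)
  have letter_D: "letter (D v) = v" if "v < b" for v
    using that D(1) by (simp add: letter_def bij_betw_def)
  define pos where "pos z = inv_into {..<m} Z z" for z
  have pos: "pos z < m" "Z (pos z) = z" if "z \<in> up_sets X pre" for z
    using that Z(1) inv_into_into[of z Z "{..<m}"] f_inv_into_f[of z Z "{..<m}"]
    by (auto simp: pos_def bij_betw_def)
  have Z_in: "Z j \<in> up_sets X pre" if "j < m" for j
    using bij_betwE[OF Z(1)] that by simp
  have D_in: "D v \<in> up_sets S preS" if "v < b" for v
    using bij_betwE[OF D(1)] that by simp
  define row where "row i = map (\<lambda>j. letter (restr i (Z j))) [0..<m]" for i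
  have D_row: "D (row i ! l) = restr i (Z l)" if "i \<in> {1..k}" "l < m" for i l
    using letter(2)[OF restr[OF Z_in that(1)]] that by (simp add: row_def)
  have "rigid 0 b (row i)" if i: "i \<in> {1..k}" for i
  proof (rule rigidI)
    show "set (row i) \<subseteq> {..<b}"
      using letter(1)[OF restr[OF Z_in i]] by (auto simp: row_def)
    show "pos (up i (D v)) < length (row i) \<and> row i ! pos (up i (D v)) = v" if "v < b" for v
      using pos[OF up[OF D_in[OF that] i]] restr_up[OF D_in[OF that] i] letter_D[OF that]
      by (simp add: row_def)
    show "pos (up i (D v)) < pos (up i (D w))" if "v < w" "w < b" for v w
    proof -
      have vw: "D v \<in> up_sets S preS" "D w \<in> up_sets S preS"
        using D_in that by auto
      have "lex_less S rkS (D v) (D w)"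
        using D(2)[of v w] that by simp
      then have "lex_less X rk (up i (D v)) (up i (D w))"
        using up_lex[OF vw i] by blast
      then show ?thesis
        using Z(2) pos[OF up[OF vw(1) i]] pos[OF up[OF vw(2) i]] by simp
    qed
    \<comment> \<open>The up-set generated by the restriction of \<open>Z j\<close> is a subset of
      \<open>Z j\<close>, and a subset never comes later.\<close>
    show "pos (up i (D (row i ! j))) \<le> j" if "j < length (row i)" for j
    proof (rule ccontr)
      have j: "j < m"
        using that by (simp add: row_def)
      let ?z = "up i (restr i (Z j))"
      have z: "?z \<in> up_sets X pre" "?z \<subseteq> Z j" "Z j \<subseteq> X"
        using up[OF restr[OF Z_in[OF j] i] i] up_restr[OF Z_in[OF j]] Z_in[OF j]
        by (auto simp: up_sets_def)
      assume "\<not> pos (up i (D (row i ! j))) \<le> j"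
      then have "j < pos ?z"
        using D_row[OF i j] by simp
      then have "lex_less X rk (Z j) ?z"
        using Z(2)[OF j, of "pos ?z"] pos[OF z(1)] by simp
      then show False
        using z(2) by (auto simp: lex_less_def)
    qed
  qed
  moreover have "length (row i) = m" for i
    by (simp add: row_def)
  moreover have "t \<in> D (row j ! l)"
    if "s \<in> S" "t \<in> S" "i \<in> {1..k}" "j \<in> {1..k}" "pre (s, i) (t, j)" "l < m" "s \<in> D (row i ! l)"
    for s t i j l
    using that Z_in[OF \<open>l < m\<close>] by (auto simp: D_row restr_def up_sets_def X_def)
  \<comment> \<open>Principal up-sets are letters; they will detect that a run starting in state
    \<open>s\<close> stays above \<open>s\<close>.\<close>
  moreover have "\<exists>v<b. D v = {t \<in> S. pre (s, 1) (t, 1)}" if "s \<in> S" for s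
  proof -
    have "pre (s, 1) (t', 1)" if "t \<in> S" "t' \<in> S" "pre (s, 1) (t, 1)" "pre (t, 1) (t', 1)" for t t'
      using trans[of "(s, 1)" "(t, 1)" "(t', 1)"] that \<open>s \<in> S\<close> one by (auto simp: X_def)
    then have "{t \<in> S. pre (s, 1) (t, 1)} \<in> up_sets S preS"
      by (auto simp: up_sets_def preS_def)
    then show ?thesis
      using letter by blast
  qed
  ultimately show ?thesis
    by (intro exI[of _ b] exI[of _ m] exI[of _ D] exI[of _ row]) blast
qed

section \<open>Order systems as pairs of preorders\<close>

text \<open>Order systems lifted from classes to elements, \<open>P\<close> for
  \<open>\<preceq>\<close> and \<open>T\<close> for \<open>\<le>\<close>, with \<open>P\<close> in
  both directions as \<open>\<sim>\<close>. The last clause makes \<open>T\<close> identify no more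
  than \<open>P\<close>, so both live on one quotient. On elements, the induced system is mere
  composition with the map.\<close>

definition order_pair :: "'a set \<Rightarrow> ('a \<Rightarrow> 'a \<Rightarrow> bool) \<Rightarrow> ('a \<Rightarrow> 'a \<Rightarrow> bool) \<Rightarrow> bool" where
  "order_pair X P T \<longleftrightarrow>
     (\<forall>x\<in>X. P x x) \<and>
     (\<forall>x\<in>X. \<forall>y\<in>X. \<forall>z\<in>X. P x y \<longrightarrow> P y z \<longrightarrow> P x z) \<and>
     (\<forall>x\<in>X. \<forall>y\<in>X. \<forall>z\<in>X. T x y \<longrightarrow> T y z \<longrightarrow> T x z) \<and>
     (\<forall>x\<in>X. \<forall>y\<in>X. T x y \<or> T y x) \<and>
     (\<forall>x\<in>X. \<forall>y\<in>X. P x y \<longrightarrow> T x y) \<and>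
     (\<forall>x\<in>X. \<forall>y\<in>X. T x y \<longrightarrow> T y x \<longrightarrow> P x y)"

definition sim_of :: "'a set \<Rightarrow> ('a \<Rightarrow> 'a \<Rightarrow> bool) \<Rightarrow> ('a \<times> 'a) set" where
  "sim_of X P = {(x, y). x \<in> X \<and> y \<in> X \<and> P x y \<and> P y x}"

definition rel_of :: "'a set \<Rightarrow> ('a \<times> 'a) set \<Rightarrow> ('a \<Rightarrow> 'a \<Rightarrow> bool) \<Rightarrow> ('a set \<times> 'a set) set" where
  "rel_of X sim R = {(sim `` {x}, sim `` {y}) |x y. x \<in> X \<and> y \<in> X \<and> R x y}"

definition triple_of :: "'a set \<Rightarrow> ('a \<Rightarrow> 'a \<Rightarrow> bool) \<Rightarrow> ('a \<Rightarrow> 'a \<Rightarrow> bool) \<Rightarrow> 'a order_triple" where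
  "triple_of X P T = (sim_of X P, rel_of X (sim_of X P) P, rel_of X (sim_of X P) T)"

lemma order_pairD:
  assumes "order_pair X P T"
  shows "x \<in> X \<Longrightarrow> P x x"
    and "x \<in> X \<Longrightarrow> y \<in> X \<Longrightarrow> z \<in> X \<Longrightarrow> P x y \<Longrightarrow> P y z \<Longrightarrow> P x z"
    and "x \<in> X \<Longrightarrow> y \<in> X \<Longrightarrow> z \<in> X \<Longrightarrow> T x y \<Longrightarrow> T y z \<Longrightarrow> T x z"
    and "x \<in> X \<Longrightarrow> y \<in> X \<Longrightarrow> T x y \<or> T y x"
    and "x \<in> X \<Longrightarrow> y \<in> X \<Longrightarrow> P x y \<Longrightarrow> T x y"
    and "x \<in> X \<Longrightarrow> y \<in> X \<Longrightarrow> T x y \<Longrightarrow> T y x \<Longrightarrow> P x y"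
  using assms unfolding order_pair_def by blast+

lemma order_pair_image:
  assumes "order_pair X P T" "g ` Y \<subseteq> X"
  shows "order_pair Y (\<lambda>x y. P (g x) (g y)) (\<lambda>x y. T (g x) (g y))"
proof -
  have "g y \<in> X" if "y \<in> Y" for y
    using assms(2) that by blast
  then show ?thesis
    using order_pairD[OF assms(1)] unfolding order_pair_def
    by (intro conjI ballI impI) meson+
qed

lemma sim_of_class_eq_iff:
  assumes "order_pair X P T" "x \<in> X" "y \<in> X"
  shows "sim_of X P `` {x} = sim_of X P `` {y} \<longleftrightarrow> P x y \<and> P y x"
proof
  assume "sim_of X P `` {x} = sim_of X P `` {y}"
  moreover have "x \<in> sim_of X P `` {x}"
    using assms order_pairD(1)[OF assms(1)] by (simp add: sim_of_def)
  ultimately have "x \<in> sim_of X P `` {y}"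
    by simp
  then show "P x y \<and> P y x"
    by (simp add: sim_of_def)
next
  assume "P x y \<and> P y x"
  then show "sim_of X P `` {x} = sim_of X P `` {y}"
    using order_pairD(2)[OF assms(1)] assms(2,3) unfolding sim_of_def by blast
qed

lemma rel_of_iff:
  assumes op: "order_pair X P T" and "x \<in> X" "y \<in> X"
  shows "(sim_of X P `` {x}, sim_of X P `` {y}) \<in> rel_of X (sim_of X P) P \<longleftrightarrow> P x y" (is ?P)
    and "(sim_of X P `` {x}, sim_of X P `` {y}) \<in> rel_of X (sim_of X P) T \<longleftrightarrow> T x y" (is ?T)
proof -
  show ?P
  proof
    assume "(sim_of X P `` {x}, sim_of X P `` {y}) \<in> rel_of X (sim_of X P) P"
    then obtain x' y' where *: "x' \<in> X" "y' \<in> X" "P x' y'"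
      "sim_of X P `` {x} = sim_of X P `` {x'}" "sim_of X P `` {y} = sim_of X P `` {y'}"
      unfolding rel_of_def by blast
    then have "P x x'" "P y' y"
      using sim_of_class_eq_iff[OF op] assms(2,3) by blast+
    then show "P x y"
      using * order_pairD(2)[OF op] assms(2,3) by meson
  qed (use assms in \<open>auto simp: rel_of_def\<close>)
  show ?T
  proof
    assume "(sim_of X P `` {x}, sim_of X P `` {y}) \<in> rel_of X (sim_of X P) T"
    then obtain x' y' where *: "x' \<in> X" "y' \<in> X" "T x' y'"
      "sim_of X P `` {x} = sim_of X P `` {x'}" "sim_of X P `` {y} = sim_of X P `` {y'}"
      unfolding rel_of_def by blast
    then have "P x x'" "P y' y"
      using sim_of_class_eq_iff[OF op] assms(2,3) by blast+
    then have "T x x'" "T y' y"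
      using order_pairD(5)[OF op] * assms(2,3) by blast+
    then show "T x y"
      using * order_pairD(3)[OF op] assms(2,3) by meson
  qed (use assms in \<open>auto simp: rel_of_def\<close>)
qed

lemma order_system_triple_of:
  assumes op: "order_pair X P T"
  shows "order_system X (triple_of X P T)"
proof -
  let ?sim = "sim_of X P"
  note iff = rel_of_iff[OF op] and eq_iff = sim_of_class_eq_iff[OF op]
  have equiv: "equiv X ?sim"
  proof (intro equivI refl_onI symI transI)
    show "(x, x) \<in> ?sim" if "x \<in> X" for x
      using that order_pairD(1)[OF op that] by (simp add: sim_of_def)
    show "(x, z) \<in> ?sim" if "(x, y) \<in> ?sim" "(y, z) \<in> ?sim" for x y z
      using that order_pairD(2)[OF op, of x y z] order_pairD(2)[OF op, of z y x]
      by (simp add: sim_of_def)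
  qed (auto simp: sim_of_def)
  have quot: "C \<in> X // ?sim \<longleftrightarrow> (\<exists>x\<in>X. C = ?sim `` {x})" for C
    by (auto simp: quotient_def)
  have sub: "rel_of X ?sim R \<subseteq> (X // ?sim) \<times> (X // ?sim)" for R
    by (auto simp: rel_of_def quotient_def)
  have cls: "\<exists>x\<in>X. \<exists>y\<in>X. C = ?sim `` {x} \<and> C' = ?sim `` {y}" if "(C, C') \<in> rel_of X ?sim R" for C C' R
    using that by (auto simp: rel_of_def)
  have prec: "partial_order_on (X // ?sim) (rel_of X ?sim P)"
    unfolding partial_order_on_def preorder_on_def
  proof (intro conjI sub refl_onI transI antisymI)
    show "(C, C) \<in> rel_of X ?sim P" if "C \<in> X // ?sim" for C
      using that iff(1) order_pairD(1)[OF op] by (auto simp: quot)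
    show "(C, C'') \<in> rel_of X ?sim P"
      if C: "(C, C') \<in> rel_of X ?sim P" "(C', C'') \<in> rel_of X ?sim P" for C C' C''
    proof -
      obtain x y where xy: "x \<in> X" "y \<in> X" "C = ?sim `` {x}" "C' = ?sim `` {y}"
        using cls[OF C(1)] by blast
      obtain z where z: "z \<in> X" "C'' = ?sim `` {z}"
        using cls[OF C(2)] by blast
      have "P x y" "P y z"
        using C iff(1) xy z by simp_all
      then have "P x z"
        using order_pairD(2)[OF op] xy z by blast
      then show ?thesis
        using iff(1) xy z by simp
    qed
    show "C = C'" if C: "(C, C') \<in> rel_of X ?sim P" "(C', C) \<in> rel_of X ?sim P" for C C'
    proof -
      obtain x y where xy: "x \<in> X" "y \<in> X" "C = ?sim `` {x}" "C' = ?sim `` {y}"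
        using cls[OF C(1)] by blast
      then have "P x y" "P y x"
        using C iff(1) by simp_all
      then show ?thesis
        using eq_iff xy by simp
    qed
  qed
  have le: "linear_order_on (X // ?sim) (rel_of X ?sim T)"
    unfolding linear_order_on_def partial_order_on_def preorder_on_def
  proof (intro conjI sub refl_onI transI antisymI)
    show "(C, C) \<in> rel_of X ?sim T" if "C \<in> X // ?sim" for C
      using that iff(2) order_pairD(4)[OF op] by (auto simp: quot)
    show "(C, C'') \<in> rel_of X ?sim T"
      if C: "(C, C') \<in> rel_of X ?sim T" "(C', C'') \<in> rel_of X ?sim T" for C C' C''
    proof -
      obtain x y where xy: "x \<in> X" "y \<in> X" "C = ?sim `` {x}" "C' = ?sim `` {y}"
        using cls[OF C(1)] by blast
      obtain z where z: "z \<in> X" "C'' = ?sim `` {z}"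
        using cls[OF C(2)] by blast
      have "T x y" "T y z"
        using C iff(2) xy z by simp_all
      then have "T x z"
        using order_pairD(3)[OF op] xy z by blast
      then show ?thesis
        using iff(2) xy z by simp
    qed
    show "C = C'" if C: "(C, C') \<in> rel_of X ?sim T" "(C', C) \<in> rel_of X ?sim T" for C C'
    proof -
      obtain x y where xy: "x \<in> X" "y \<in> X" "C = ?sim `` {x}" "C' = ?sim `` {y}"
        using cls[OF C(1)] by blast
      then have "T x y" "T y x"
        using C iff(2) by simp_all
      then have "P x y" "P y x"
        using order_pairD(6)[OF op] xy by blast+
      then show ?thesis
        using eq_iff xy by simp
    qed
    show "total_on (X // ?sim) (rel_of X ?sim T)"
    proof (rule total_onI)
      fix C C'
      assume "C \<in> X // ?sim" "C' \<in> X // ?sim"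
      then obtain x y where "x \<in> X" "y \<in> X" "C = ?sim `` {x}" "C' = ?sim `` {y}"
        unfolding quot by (elim bexE)
      then show "(C, C') \<in> rel_of X ?sim T \<or> (C', C) \<in> rel_of X ?sim T"
        using iff(2) order_pairD(4)[OF op, of x y] by simp
    qed
  qed
  have "rel_of X ?sim P \<subseteq> rel_of X ?sim T"
    using order_pairD(5)[OF op] by (auto simp: rel_of_def)
  then show ?thesis
    using equiv prec le by (simp add: order_system_def triple_of_def)
qed

lemma order_system_imp_triple_of:
  assumes "order_system X \<Omega>"
  shows "\<exists>P T. order_pair X P T \<and> \<Omega> = triple_of X P T"
proof -
  obtain sim prec le where \<Omega>: "\<Omega> = (sim, prec, le)"
    by (cases \<Omega>)
  have equiv: "equiv X sim" and prec: "partial_order_on (X // sim) prec"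
    and le: "linear_order_on (X // sim) le" and "prec \<subseteq> le"
    using assms by (auto simp: order_system_def \<Omega>)
  note prec' = partial_order_onD[OF prec]
  have "partial_order_on (X // sim) le" "total_on (X // sim) le"
    using le by (auto simp: linear_order_on_def)
  note le' = partial_order_onD[OF this(1)] this(2)
  define P where "P x y \<longleftrightarrow> (sim `` {x}, sim `` {y}) \<in> prec" for x y
  define T where "T x y \<longleftrightarrow> (sim `` {x}, sim `` {y}) \<in> le" for x y
  have cls: "sim `` {x} \<in> X // sim" if "x \<in> X" for x
    using that by (rule quotientI)
  have "order_pair X P T"
    unfolding order_pair_def
  proof (intro conjI ballI impI)
    show "P x x" if "x \<in> X" for x
      using prec'(1) cls[OF that] by (auto simp: P_def refl_on_def)
    show "P x z" if "P x y" "P y z" for x y z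
      using prec'(2) that unfolding P_def by (rule transD)
    show "T x z" if "T x y" "T y z" for x y z
      using le'(2) that unfolding T_def by (rule transD)
    show "T x y \<or> T y x" if "x \<in> X" "y \<in> X" for x y
      using le'(1,5) cls[OF that(1)] cls[OF that(2)] unfolding T_def refl_on_def total_on_def by metis
    show "T x y" if "P x y" for x y
      using that \<open>prec \<subseteq> le\<close> by (auto simp: P_def T_def)
    show "P x y" if "x \<in> X" "y \<in> X" "T x y" "T y x" for x y
      using antisymD[OF le'(3)] that prec'(1) cls unfolding P_def T_def refl_on_def by metis
  qed
  moreover have sim: "sim = sim_of X P"
  proof -
    have "(x, y) \<in> sim \<longleftrightarrow> x \<in> X \<and> y \<in> X \<and> P x y \<and> P y x" for x y
    proof
      assume xy: "(x, y) \<in> sim"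
      then have "x \<in> X" "y \<in> X"
        using equiv by (auto simp: equiv_def)
      moreover have "sim `` {x} = sim `` {y}"
        using equiv_class_eq[OF equiv xy] .
      ultimately show "x \<in> X \<and> y \<in> X \<and> P x y \<and> P y x"
        using prec'(1) cls by (simp add: P_def refl_on_def)
    next
      assume "x \<in> X \<and> y \<in> X \<and> P x y \<and> P y x"
      then show "(x, y) \<in> sim"
        using antisymD[OF prec'(3)] eq_equiv_class[OF _ equiv] unfolding P_def by blast
    qed
    then show ?thesis
      by (auto simp: sim_of_def)
  qed
  moreover have "R = rel_of X sim (\<lambda>x y. (sim `` {x}, sim `` {y}) \<in> R)"
    if R: "R \<subseteq> (X // sim) \<times> (X // sim)" for R
  proof (intro equalityI subrelI)
    fix C C'
    assume "(C, C') \<in> R"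
    moreover from this have "C \<in> X // sim" "C' \<in> X // sim"
      using R by auto
    ultimately show "(C, C') \<in> rel_of X sim (\<lambda>x y. (sim `` {x}, sim `` {y}) \<in> R)"
      by (auto simp: rel_of_def elim!: quotientE)
  qed (auto simp: rel_of_def)
  then have "prec = rel_of X sim P" "le = rel_of X sim T"
    using prec'(4) le'(4) unfolding P_def[abs_def] T_def[abs_def] by blast+
  ultimately show ?thesis
    using \<Omega> unfolding triple_of_def by blast
qed

lemma triple_of_inject:
  assumes "order_pair X P T" "order_pair X P' T'" "triple_of X P T = triple_of X P' T'"
    and "x \<in> X" "y \<in> X"
  shows "P x y \<longleftrightarrow> P' x y" "T x y \<longleftrightarrow> T' x y"
proof -
  have "sim_of X P = sim_of X P'"
    "rel_of X (sim_of X P) P = rel_of X (sim_of X P') P'"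
    "rel_of X (sim_of X P) T = rel_of X (sim_of X P') T'"
    using assms(3) unfolding triple_of_def prod.inject by blast+
  then show "P x y \<longleftrightarrow> P' x y" "T x y \<longleftrightarrow> T' x y"
    using rel_of_iff[OF assms(1,4,5)] rel_of_iff[OF assms(2,4,5)] by metis+
qed

lemma induced_sim_of:
  assumes "g ` Y \<subseteq> X"
  shows "induced_sim g Y (sim_of X P) = sim_of Y (\<lambda>y z. P (g y) (g z))"
  using assms by (auto simp: induced_sim_def sim_of_def)

lemma induced_system_triple_of:
  assumes op: "order_pair X P T" and g: "g ` Y \<subseteq> X"
  shows "induced_system g Y (triple_of X P T) =
    triple_of Y (\<lambda>y z. P (g y) (g z)) (\<lambda>y z. T (g y) (g z))"
proof -
  let ?sim = "sim_of Y (\<lambda>y z. P (g y) (g z))"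
  have g': "g y \<in> X" if "y \<in> Y" for y
    using g that by blast
  have "induced_rel g Y (sim_of X P) (rel_of X (sim_of X P) P) = rel_of Y ?sim (\<lambda>y z. P (g y) (g z))"
    unfolding induced_rel_def induced_sim_of[OF g] rel_of_def[of Y]
    using rel_of_iff(1)[OF op] g' by blast
  moreover have "induced_rel g Y (sim_of X P) (rel_of X (sim_of X P) T) = rel_of Y ?sim (\<lambda>y z. T (g y) (g z))"
    unfolding induced_rel_def induced_sim_of[OF g] rel_of_def[of Y]
    using rel_of_iff(2)[OF op] g' by blast
  ultimately show ?thesis
    by (simp add: induced_system_def triple_of_def induced_sim_of[OF g])
qed

text \<open>The machine enters because \<open>t \<in> f s (i, j)\<close> has to lie in
  \<open>S\<close> before the classes in condition (1) can be traded for elements.\<close>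

lemma compatible_triple_of_iff:
  assumes op: "order_pair (S \<times> {1..k}) P T" and M: "machine k S f B"
  shows "compatible k S f B (triple_of (S \<times> {1..k}) P T) \<longleftrightarrow>
     (\<forall>s\<in>S. \<forall>i\<in>{1..k}. \<forall>j\<in>{1..k}. \<forall>t\<in>f s (i, j). P (s, i) (t, j)) \<and>
     (\<forall>i\<in>{1..k}. \<forall>j\<in>{1..k}.
        triple_of S (\<lambda>s t. P (s, i) (t, i)) (\<lambda>s t. T (s, i) (t, i)) =
        triple_of S (\<lambda>s t. P (s, j) (t, j)) (\<lambda>s t. T (s, j) (t, j))) \<and>
     (\<forall>i\<in>{1..k}. \<forall>s\<in>S. \<forall>t\<in>S. P (s, i) (t, i) \<longrightarrow> (s, t) \<notin> B)"
    (is "_ \<longleftrightarrow> ?A \<and> ?B \<and> ?C")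
proof -
  define K where "K = {1..k}"
  have op: "order_pair (S \<times> K) P T"
    using op by (simp only: K_def)
  let ?\<Omega> = "triple_of (S \<times> K) P T" and ?sim = "sim_of (S \<times> K) P"
  have sub: "(\<lambda>s. (s, i)) ` S \<subseteq> S \<times> K" if "i \<in> K" for i
    using that by auto
  have f: "t \<in> S" if "s \<in> S" "i \<in> K" "j \<in> K" "t \<in> f s (i, j)" for s t i j
    using M that unfolding machine_def K_def by blast
  have 1: "(?sim `` {(s, i)}, ?sim `` {(t, j)}) \<in> rel_of (S \<times> K) ?sim P \<longleftrightarrow> P (s, i) (t, j)"
    if "s \<in> S" "i \<in> K" "j \<in> K" "t \<in> f s (i, j)" for s t i j
    by (rule rel_of_iff(1)[OF op]) (use that f[OF that] in auto)
  have 2: "induced_system (\<lambda>s. (s, i)) S (?sim, rel_of (S \<times> K) ?sim P, rel_of (S \<times> K) ?sim T) =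
      triple_of S (\<lambda>s t. P (s, i) (t, i)) (\<lambda>s t. T (s, i) (t, i))" if "i \<in> K" for i
    using induced_system_triple_of[OF op sub[OF that]] by (simp only: triple_of_def)
  have 3: "(induced_sim (\<lambda>s. (s, i)) S ?sim `` {s}, induced_sim (\<lambda>s. (s, i)) S ?sim `` {t})
      \<in> induced_rel (\<lambda>s. (s, i)) S ?sim (rel_of (S \<times> K) ?sim P) \<longleftrightarrow> P (s, i) (t, i)"
    if "i \<in> K" "s \<in> S" "t \<in> S" for i s t
  proof -
    have "induced_rel (\<lambda>s. (s, i)) S ?sim (rel_of (S \<times> K) ?sim P) =
        rel_of S (sim_of S (\<lambda>s t. P (s, i) (t, i))) (\<lambda>s t. P (s, i) (t, i))"
      using 2[OF that(1)] by (simp only: induced_system_def triple_of_def case_prod_conv prod.inject)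
    then show ?thesis
      using rel_of_iff(1)[OF order_pair_image[OF op sub[OF that(1)]] that(2,3)]
      by (simp only: induced_sim_of[OF sub[OF that(1)]])
  qed
  show ?thesis
    unfolding compatible_def K_def[symmetric] triple_of_def[of "S \<times> K"] case_prod_conv
    by (intro arg_cong2[where f = "(\<and>)"] ball_cong refl) (simp_all only: 1 2 3)
qed

text \<open>\<open>card\<close> of an infinite set is \<open>0\<close>, so this gives the bound in
  the theorem its meaning; it also allows order systems to be encoded as the colours
  \<open>1, ..., \<chi>\<close>.\<close>

lemma finite_order_systems:
  assumes "finite S"
  shows "finite {\<Omega>. order_system S \<Omega>}"
proof (rule finite_subset)
  show "{\<Omega>. order_system S \<Omega>} \<subseteq>
      Pow (S \<times> S) \<times> Pow (Pow S \<times> Pow S) \<times> Pow (Pow S \<times> Pow S)"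
  proof
    fix \<Omega>
    assume "\<Omega> \<in> {\<Omega>. order_system S \<Omega>}"
    then obtain P T where "\<Omega> = triple_of S P T"
      using order_system_imp_triple_of by blast
    then show "\<Omega> \<in> Pow (S \<times> S) \<times> Pow (Pow S \<times> Pow S) \<times> Pow (Pow S \<times> Pow S)"
      by (auto simp: triple_of_def rel_of_def sim_of_def)
  qed
  show "finite (Pow (S \<times> S) \<times> Pow (Pow S \<times> Pow S) \<times> Pow (Pow S \<times> Pow S))"
    using assms by simp
qed

text \<open>Szpilrajn's theorem for preorders, without merging classes. Sending \<open>x\<close> to
  \<open>down x\<close> embeds the preorder into sets ordered by inclusion, and the lexicographic
  comparison \<open>before\<close> of sets along a well-order of the type extends inclusion.\<close>

lemma linear_extension:
  fixes P :: "'a \<Rightarrow> 'a \<Rightarrow> bool"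
  assumes "reflp P" "transp P"
  shows "\<exists>T. order_pair UNIV P T"
proof -
  obtain r :: "'a rel" where r: "well_order_on UNIV r"
    using well_order_on by blast
  define less where "less u v \<longleftrightarrow> (u, v) \<in> r - Id" for u v
  have wf: "wf (r - Id)" and "linear_order_on UNIV r"
    using r by (auto simp: well_order_on_def)
  then have less_linear: "less u v \<or> u = v \<or> less v u" for u v
    by (auto simp: less_def linear_order_on_def total_on_def)
  have less_trans: "less u v \<Longrightarrow> less v w \<Longrightarrow> less u w" for u v w
    using \<open>linear_order_on UNIV r\<close> unfolding less_def linear_order_on_def partial_order_on_def preorder_on_def
    by (metis Diff_iff antisymD pair_in_Id_conv transD)
  define down where "down x = {z. P z x}" for x
  have down_mono: "down x \<subseteq> down y" if "P x y" for x y
    using transpD[OF assms(2)] that by (auto simp: down_def)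
  have down_iff: "P x y \<longleftrightarrow> x \<in> down y" for x y
    by (simp add: down_def)
  have down_refl: "x \<in> down x" for x
    using reflpD[OF assms(1)] by (simp add: down_def)
  define before where
    "before x y \<longleftrightarrow> (\<exists>z\<in>down y - down x. \<forall>u. less u z \<longrightarrow> (u \<in> down x \<longleftrightarrow> u \<in> down y))" for x y
  have before_linear: "before x y \<or> before y x" if "down x \<noteq> down y" for x y
  proof -
    have "\<exists>z. z \<in> (down x - down y) \<union> (down y - down x)"
      using that by blast
    then obtain z where z: "z \<in> (down x - down y) \<union> (down y - down x)"
      "\<And>u. less u z \<Longrightarrow> u \<notin> (down x - down y) \<union> (down y - down x)"
      using wfE_min[OF wf] unfolding less_def by metis
    then show ?thesis
      unfolding before_def by blast
  qed
  have before_trans: "before x w" if xy: "before x y" and yw: "before y w" for x y w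
  proof -
    obtain p where p: "p \<in> down y" "p \<notin> down x" "\<And>u. less u p \<Longrightarrow> u \<in> down x \<longleftrightarrow> u \<in> down y"
      using xy unfolding before_def by blast
    obtain q where q: "q \<in> down w" "q \<notin> down y" "\<And>u. less u q \<Longrightarrow> u \<in> down y \<longleftrightarrow> u \<in> down w"
      using yw unfolding before_def by blast
    consider "less p q" | "less q p"
      using less_linear[of p q] p(1) q(2) by auto
    then show ?thesis
    proof cases
      case 1
      then have "p \<in> down w - down x" "\<And>u. less u p \<Longrightarrow> u \<in> down x \<longleftrightarrow> u \<in> down w"
        using p q(3) less_trans by blast+
      then show ?thesis
        unfolding before_def by blast
    next
      case 2
      then have "q \<in> down w - down x" "\<And>u. less u q \<Longrightarrow> u \<in> down x \<longleftrightarrow> u \<in> down w"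
        using q p(3) less_trans by blast+
      then show ?thesis
        unfolding before_def by blast
    qed
  qed
  have before_irrefl: "\<not> before x y" if "down x = down y" for x y
    using that by (simp add: before_def)
  have before_cong: "before x y \<longleftrightarrow> before x' y'" if "down x = down x'" "down y = down y'" for x y x' y'
    using that by (simp add: before_def)
  define T where "T x y \<longleftrightarrow> down x = down y \<or> before x y" for x y
  have "order_pair UNIV P T"
    unfolding order_pair_def
  proof (intro conjI ballI impI)
    show "P x x" for x
      using reflpD[OF assms(1)] .
    show "P x z" if "P x y" "P y z" for x y z
      using transpD[OF assms(2) that] .
    show "T x z" if "T x y" "T y z" for x y z
      using that before_trans before_cong unfolding T_def by metis
    show "T x y \<or> T y x" for x y
      using before_linear unfolding T_def by metis
    show "T x y" if "P x y" for x y
    proof (cases "down x = down y")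
      case False
      then show ?thesis
        using before_linear[OF False] down_mono[OF that] unfolding T_def before_def by blast
    qed (simp add: T_def)
    show "P x y" if "T x y" "T y x" for x y
    proof -
      have "down x = down y"
        using that before_trans[of x y x] before_irrefl[of x x] unfolding T_def by metis
      then show ?thesis
        using down_refl[of x] by (simp add: down_iff)
    qed
  qed
  then show ?thesis by blast
qed

section \<open>Machines running on hypergraphs\<close>

lemma coord_in_set:
  assumes "length e = k" "a \<in> {1..k}"
  shows "coord e a \<in> set e"
  unfolding coord_def by (rule nth_mem) (use assms in auto)

lemma in_set_coordE:
  assumes "x \<in> set e" "length e = k"
  obtains a where "a \<in> {1..k}" "coord e a = x"
proof -
  obtain l where "l < length e" "e ! l = x"
    using assms(1) by (auto simp: in_set_conv_nth)
  then show thesis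
    using that[of "Suc l"] assms(2) by (auto simp: coord_def)
qed

lemma coord_inject:
  assumes "length e = k" "distinct e" "a \<in> {1..k}" "b \<in> {1..k}" "coord e a = coord e b"
  shows "a = b"
proof -
  have "a - 1 = b - 1"
    using assms by (auto simp: coord_def nth_eq_iff_index_eq)
  then show ?thesis
    using assms(3,4) by auto
qed

lemma trace_eq:
  assumes "length (e i) = k" "distinct (e i)" "a \<in> {1..k}" "b \<in> {1..k}"
    and "coord (e i) a = v (i - 1)" "coord (e i) b = v i"
  shows "trace k v e i = (a, b)"
  unfolding trace_def
proof (rule the_equality)
  show "case (a, b) of (a, b) \<Rightarrow> a \<in> {1..k} \<and> b \<in> {1..k} \<and> coord (e i) a = v (i - 1) \<and> coord (e i) b = v i"
    using assms by simp
  show "p = (a, b)" if "case p of (a, b) \<Rightarrow> a \<in> {1..k} \<and> b \<in> {1..k} \<and>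
      coord (e i) a = v (i - 1) \<and> coord (e i) b = v i" for p
  proof -
    obtain a' b' where p: "p = (a', b')"
      by (cases p)
    with that have "a' \<in> {1..k}" "b' \<in> {1..k}"
      "coord (e i) a' = coord (e i) a" "coord (e i) b' = coord (e i) b"
      using assms(5,6) by simp_all
    then have "a' = a" "b' = b"
      using coord_inject[OF assms(1,2)] assms(3,4) by blast+
    then show ?thesis
      using p by simp
  qed
qed

text \<open>With this step relation a bad cycle is a path from \<open>(v, s)\<close> to
  \<open>(v, t)\<close> with \<open>(s, t) \<in> B\<close>; cycles of length \<open>0\<close> are
  the reason for the reflexive closure below. The condition \<open>s \<in> S\<close> is there since
  \<open>f\<close> is constrained on \<open>S\<close> only.\<close>

definition machine_step ::
  "nat \<Rightarrow> 's set \<Rightarrow> ('s \<Rightarrow> nat \<times> nat \<Rightarrow> 's set) \<Rightarrow> 'v list set \<Rightarrow> 'v \<times> 's \<Rightarrow> 'v \<times> 's \<Rightarrow> bool" where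
  "machine_step k S f E = (\<lambda>(v, s) (w, t). s \<in> S \<and>
     (\<exists>e\<in>E. \<exists>a\<in>{1..k}. \<exists>b\<in>{1..k}. coord e a = v \<and> coord e b = w \<and> t \<in> f s (a, b)))"

lemma good_hypergraph_reachable:
  assumes M: "machine k S f B" and H: "uniform_dihypergraph k V E" and good: "good_hypergraph k S f B V E"
    and "v \<in> V" "s \<in> S" and reach: "(machine_step k S f E)\<^sup>*\<^sup>* (v, s) (v, t)"
  shows "(s, t) \<notin> B"
proof
  assume "(s, t) \<in> B"
  obtain n where "((machine_step k S f E) ^^ n) (v, s) (v, t)"
    using rtranclp_imp_relpowp[OF reach] by blast
  then obtain x where x: "x 0 = (v, s)" "x n = (v, t)" "\<And>i. i < n \<Longrightarrow> machine_step k S f E (x i) (x (Suc i))"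
    by (auto simp: relpowp_fun_conv)
  define vs where "vs i = fst (x i)" for i
  define ss where "ss i = snd (x i)" for i
  define Q where "Q i = (\<lambda>(e, a, b). e \<in> E \<and> a \<in> {1..k} \<and> b \<in> {1..k} \<and>
      coord e a = vs i \<and> coord e b = vs (Suc i) \<and> ss (Suc i) \<in> f (ss i) (a, b) \<and> ss i \<in> S)" for i
  have "\<forall>i. \<exists>z. i < n \<longrightarrow> Q i z"
  proof
    fix i
    have "machine_step k S f E (vs i, ss i) (vs (Suc i), ss (Suc i))" if "i < n"
      using x(3)[OF that] by (simp add: vs_def ss_def)
    then have "i < n \<longrightarrow> (\<exists>e a b. Q i (e, a, b))"
      unfolding machine_step_def Q_def case_prod_conv by blast
    then show "\<exists>z. i < n \<longrightarrow> Q i z"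
      by blast
  qed
  then obtain z where z: "\<forall>i. i < n \<longrightarrow> Q i (z i)"
    by (rule choice[THEN exE])
  define e where "e i = fst (z i)" for i
  define a where "a i = fst (snd (z i))" for i
  define b where "b i = snd (snd (z i))" for i
  have step: "e i \<in> E \<and> a i \<in> {1..k} \<and> b i \<in> {1..k} \<and>
      coord (e i) (a i) = vs i \<and> coord (e i) (b i) = vs (Suc i) \<and>
      ss (Suc i) \<in> f (ss i) (a i, b i) \<and> ss i \<in> S" if "i < n" for i
    using z that unfolding Q_def e_def a_def b_def case_prod_beta by blast
  \<comment> \<open>The edges of a cycle are numbered from \<open>1\<close>, the steps of the path
    from \<open>0\<close>.\<close>
  define es where "es i = e (i - 1)" for i
  have edge: "length (e i) = k" "distinct (e i)" "set (e i) \<subseteq> V" if "i < n" for i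
    using H step[OF that] by (auto simp: uniform_dihypergraph_def)
  have pred: "i - 1 < n" "Suc (i - 1) = i" if "i \<in> {1..n}" for i
    using that by auto
  have mem: "vs (i - 1) \<in> set (es i)" "vs i \<in> set (es i)" "es i \<in> E" "trace k vs es i = (a (i - 1), b (i - 1))"
    "ss i \<in> S" "vs i \<in> V" "ss i \<in> f (ss (i - 1)) (trace k vs es i)" if "i \<in> {1..n}" for i
  proof -
    note st = step[OF pred(1)[OF that], unfolded pred(2)[OF that]] and ed = edge[OF pred(1)[OF that]]
    show "vs (i - 1) \<in> set (es i)" "vs i \<in> set (es i)" "es i \<in> E"
      using st coord_in_set[OF ed(1)] unfolding es_def by metis+
    then show "vs i \<in> V"
      using ed(3) by (auto simp: es_def)
    show tr: "trace k vs es i = (a (i - 1), b (i - 1))"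
      using st ed by (intro trace_eq) (auto simp: es_def)
    show "ss i \<in> S"
      using st M unfolding machine_def by blast
    show "ss i \<in> f (ss (i - 1)) (trace k vs es i)"
      using st tr by simp
  qed
  have ends: "vs 0 = v" "vs n = v" "ss 0 = s" "ss n = t"
    using x by (simp_all add: vs_def ss_def)
  have all: "vs i \<in> V" "ss i \<in> S" if "i \<in> {0..n}" for i
  proof -
    have "i = 0 \<or> i \<in> {1..n}"
      using that by auto
    then show "vs i \<in> V" "ss i \<in> S"
      using mem(5,6)[of i] ends \<open>v \<in> V\<close> \<open>s \<in> S\<close> by blast+
  qed
  have "is_cycle V E n vs es"
    unfolding is_cycle_def using all(1) ends(1,2) mem(1-3) by simp
  moreover have "bad_cycle k S f B n vs es"
    unfolding bad_cycle_def
  proof (intro exI conjI ballI)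
    show "ss i \<in> S" if "i \<in> {0..n}" for i
      using all(2) that .
    show "ss i \<in> f (ss (i - 1)) (trace k vs es i)" if "i \<in> {1..n}" for i
      using mem(7) that .
    show "(ss 0, ss n) \<in> B"
      using ends \<open>(s, t) \<in> B\<close> by simp
  qed
  ultimately show False
    using good unfolding good_hypergraph_def by blast
qed

section \<open>Compatible order systems from good hypergraphs of large chromatic number\<close>

lemma compatible_system_of_chromatic_number:
  fixes V :: "'v set" and S :: "'s set"
  assumes M: "machine k S f B" and H: "uniform_dihypergraph k V E" and good: "good_hypergraph k S f B V E"
    and chi: "\<not> chromatic_number k V E \<le> enat (card {\<Omega>. order_system S \<Omega>})"
  shows "\<exists>\<Omega>. order_system (S \<times> {1..k}) \<Omega> \<and> compatible k S f B \<Omega>"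
proof -
  define P where "P = (machine_step k S f E)\<^sup>*\<^sup>*"
  have "reflp P"
    by (rule reflpI) (simp add: P_def)
  moreover have "transp P"
    unfolding P_def by (rule transpI) (rule rtranclp_trans)
  ultimately obtain T where op: "order_pair UNIV P T"
    using linear_extension by blast
  define col where "col v = triple_of S (\<lambda>s t. P (v, s) (v, t)) (\<lambda>s t. T (v, s) (v, t))" for v
  have sys: "order_system S (col v)" for v
    unfolding col_def by (rule order_system_triple_of, rule order_pair_image[OF op]) simp
  define \<chi> where "\<chi> = card {\<Omega>. order_system S \<Omega>}"
  have "finite {\<Omega>. order_system S \<Omega>}"
    using M by (intro finite_order_systems) (simp add: machine_def)
  then obtain enc where enc: "bij_betw enc {\<Omega>. order_system S \<Omega>} {1..\<chi>}"
    using finite_same_card_bij[of "{\<Omega>. order_system S \<Omega>}" "{1..\<chi>}"] \<chi>_def by fastforce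
  have "\<not> proper_colouring k V E \<chi> (enc \<circ> col)"
  proof
    assume "proper_colouring k V E \<chi> (enc \<circ> col)"
    then have "chromatic_number k V E \<le> enat \<chi>"
      unfolding chromatic_number_def by (intro Inf_lower) blast
    then show False
      using chi by (simp add: \<chi>_def)
  qed
  moreover have "enc \<circ> col \<in> V \<rightarrow> {1..\<chi>}"
  proof (rule Pi_I)
    show "(enc \<circ> col) v \<in> {1..\<chi>}" for v
      using bspec[OF bij_betwE[OF enc], of "col v"] sys by simp
  qed
  ultimately obtain e where e: "e \<in> E"
    "\<And>i j. i \<in> {1..k} \<Longrightarrow> j \<in> {1..k} \<Longrightarrow> enc (col (coord e i)) = enc (col (coord e j))"
    unfolding proper_colouring_def comp_apply by blast
  have mono: "col (coord e i) = col (coord e j)" if "i \<in> {1..k}" "j \<in> {1..k}" for i j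
    using inj_onD[OF bij_betw_imp_inj_on[OF enc] e(2)[OF that]] sys by simp
  define g where "g = (\<lambda>(s :: 's, i). (coord e i, s))"
  let ?P = "\<lambda>x y. P (g x) (g y)" and ?T = "\<lambda>x y. T (g x) (g y)"
  have op': "order_pair (S \<times> {1..k}) ?P ?T"
    by (rule order_pair_image[OF op]) simp
  have "compatible k S f B (triple_of (S \<times> {1..k}) ?P ?T)"
    unfolding compatible_triple_of_iff[OF op' M]
  proof (intro conjI ballI impI)
    show "?P (s, i) (t, j)" if "s \<in> S" "i \<in> {1..k}" "j \<in> {1..k}" "t \<in> f s (i, j)" for s i j t
    proof -
      have "machine_step k S f E (coord e i, s) (coord e j, t)"
        unfolding machine_step_def using that e(1) by blast
      then show ?thesis
        unfolding P_def g_def by simp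
    qed
    \<comment> \<open>Condition (2) says exactly that the coordinates \<open>i\<close> and
      \<open>j\<close> of the edge have the same colour.\<close>
    show "triple_of S (\<lambda>s t. ?P (s, i) (t, i)) (\<lambda>s t. ?T (s, i) (t, i)) =
        triple_of S (\<lambda>s t. ?P (s, j) (t, j)) (\<lambda>s t. ?T (s, j) (t, j))"
      if "i \<in> {1..k}" "j \<in> {1..k}" for i j
      using mono[OF that] by (simp add: col_def g_def)
    show "(s, t) \<notin> B" if "i \<in> {1..k}" "s \<in> S" "t \<in> S" "?P (s, i) (t, i)" for i s t
    proof (rule good_hypergraph_reachable[OF M H good])
      show "coord e i \<in> V"
      proof -
        have "length e = k" "set e \<subseteq> V"
          using H e(1) by (auto simp: uniform_dihypergraph_def)
        then show ?thesis
          using coord_in_set[of e k i] that(1) by blast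
      qed
      show "(machine_step k S f E)\<^sup>*\<^sup>* (coord e i, s) (coord e i, t)"
        using that(4) by (simp add: P_def g_def)
    qed (rule that(2))
  qed
  then show ?thesis
    using order_system_triple_of[OF op'] by (intro exI conjI)
qed

section \<open>Good hypergraphs of infinite chromatic number from compatible order systems\<close>

lemma good_hypergraphI:
  assumes H: "uniform_dihypergraph k V E"
    and B: "\<And>v s t. v \<in> V \<Longrightarrow> s \<in> S \<Longrightarrow> t \<in> S \<Longrightarrow> (machine_step k S f E)\<^sup>*\<^sup>* (v, s) (v, t) \<Longrightarrow> (s, t) \<notin> B"
  shows "good_hypergraph k S f B V E"
  unfolding good_hypergraph_def
proof
  assume "\<exists>n v e. is_cycle V E n v e \<and> bad_cycle k S f B n v e"
  then obtain n v e s where cycle: "is_cycle V E n v e"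
    and s: "\<And>i. i \<in> {0..n} \<Longrightarrow> s i \<in> S" "\<And>i. i \<in> {1..n} \<Longrightarrow> s i \<in> f (s (i - 1)) (trace k v e i)"
      "(s 0, s n) \<in> B"
    unfolding bad_cycle_def by blast
  have "(machine_step k S f E)\<^sup>*\<^sup>* (v 0, s 0) (v i, s i)" if "i \<le> n" for i
    using that
  proof (induction i)
    case (Suc i)
    then have i: "Suc i \<in> {1..n}" "i \<in> {0..n}"
      by auto
    have e: "e (Suc i) \<in> E" "v i \<in> set (e (Suc i))" "v (Suc i) \<in> set (e (Suc i))"
      using cycle i(1) unfolding is_cycle_def by force+
    then have len: "length (e (Suc i)) = k" "distinct (e (Suc i))"
      using H by (auto simp: uniform_dihypergraph_def)
    obtain a where a: "a \<in> {1..k}" "coord (e (Suc i)) a = v i"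
      using in_set_coordE[OF e(2) len(1)] .
    obtain b where b: "b \<in> {1..k}" "coord (e (Suc i)) b = v (Suc i)"
      using in_set_coordE[OF e(3) len(1)] .
    have "trace k v e (Suc i) = (a, b)"
      by (rule trace_eq) (use len a b in simp_all)
    then have "s (Suc i) \<in> f (s i) (a, b)"
      using s(2)[OF i(1)] by simp
    then have "machine_step k S f E (v i, s i) (v (Suc i), s (Suc i))"
      unfolding machine_step_def case_prod_conv using s(1)[OF i(2)] e(1) a b by blast
    then show ?case
      using Suc by (auto intro: rtranclp.rtrancl_into_rtrancl)
  qed simp
  moreover have "v n = v 0" "v 0 \<in> V"
    using cycle by (auto simp: is_cycle_def)
  ultimately show False
    using B[of "v 0" "s 0" "s n"] s by force
qed

text \<open>The rank of \<open>x\<close> counts the elements strictly below \<open>x\<close>; by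
  totality these are the \<open>z\<close> with \<open>\<not> T x z\<close>.\<close>

lemma total_preorder_rank:
  fixes T :: "'a \<Rightarrow> 'a \<Rightarrow> bool"
  assumes "finite X" and op: "order_pair X P T"
  shows "\<exists>rk :: 'a \<Rightarrow> nat. \<forall>x\<in>X. \<forall>y\<in>X. rk x \<le> rk y \<longleftrightarrow> T x y"
proof -
  define rk where "rk x = card {z \<in> X. \<not> T x z}" for x
  have le: "rk x \<le> rk y" if "x \<in> X" "y \<in> X" "T x y" for x y
    unfolding rk_def
    by (rule card_mono) (use \<open>finite X\<close> order_pairD(3)[OF op that(1,2) _ that(3)] in auto)
  have "rk y < rk x" if xy: "x \<in> X" "y \<in> X" "\<not> T x y" for x y
    unfolding rk_def
  proof (rule psubset_card_mono)
    have "T y x" "T y y"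
      using order_pairD(4)[OF op] xy by blast+
    then have "{z \<in> X. \<not> T y z} \<subseteq> {z \<in> X. \<not> T x z}"
      using order_pairD(3)[OF op \<open>y \<in> X\<close> \<open>x \<in> X\<close>] by blast
    then show "{z \<in> X. \<not> T y z} \<subset> {z \<in> X. \<not> T x z}"
      using \<open>T y y\<close> xy by blast
  qed (use \<open>finite X\<close> in simp)
  then show ?thesis
    using le by (metis not_le)
qed

text \<open>
  The vertices are pairs of a number and a word, and the edges are the tuples of the \<open>k\<close>
  rows of a matrix whose columns are columns of \<open>row\<close>. The number only serves to keep the rows
  apart when the words coincide.
\<close>

lemma good_hypergraph_of_rows:
  fixes S :: "'s set" and row :: "nat \<Rightarrow> nat list" and D :: "nat \<Rightarrow> 's set"
  assumes "infinite (UNIV :: 'v set)" and M: "machine k S f B"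
    and row: "\<And>i. i \<in> {1..k} \<Longrightarrow> rigid 0 b (row i) \<and> length (row i) = m"
    and step: "\<And>s t i j l. s \<in> S \<Longrightarrow> i \<in> {1..k} \<Longrightarrow> j \<in> {1..k} \<Longrightarrow> t \<in> f s (i, j) \<Longrightarrow>
       l < m \<Longrightarrow> s \<in> D (row i ! l) \<Longrightarrow> t \<in> D (row j ! l)"
    and D: "\<And>s. s \<in> S \<Longrightarrow> \<exists>v<b. s \<in> D v \<and> (\<forall>t\<in>S. t \<in> D v \<longrightarrow> (s, t) \<notin> B)"
  shows "\<exists>(V :: 'v set) E. uniform_dihypergraph k V E \<and> good_hypergraph k S f B V E \<and>
    chromatic_number k V E = \<infinity>"
proof -
  obtain \<iota>' :: "nat \<Rightarrow> 'v" where "inj \<iota>'"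
    using infinite_countable_subset[OF assms(1)] by blast
  \<comment> \<open>There are only countably many pairs of a number and a word, so the vertices fit
    into any infinite type.\<close>
  define \<iota> :: "nat \<times> nat list \<Rightarrow> 'v" where "\<iota> = \<iota>' \<circ> to_nat"
  have "inj \<iota>"
    unfolding \<iota>_def by (rule inj_compose[OF \<open>inj \<iota>'\<close> inj_to_nat])
  define line where "line i h = map ((!) (row i)) h" for i h
  define edge where "edge ps h = map (\<lambda>i. \<iota> (ps i, line i h)) [1..<Suc k]" for ps h
  define V where "V = \<iota> ` {(p, x). set x = {..<b}}"
  define E where "E = {edge ps h |ps h. inj_on ps {1..k} \<and> set h = {..<m}}"
  have coord: "coord (edge ps h) i = \<iota> (ps i, line i h)" if "i \<in> {1..k}" for ps h i
  proof -
    have "i - 1 < length [1..<Suc k]" "[1..<Suc k] ! (i - 1) = i"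
      using that by (auto simp del: upt_Suc)
    then show ?thesis
      unfolding coord_def edge_def by (simp only: nth_map)
  qed
  have set_line: "set (line i h) = {..<b}" if "i \<in> {1..k}" "set h = {..<m}" for i h
  proof -
    have "set (line i h) = (!) (row i) ` {0..<length (row i)}"
      using row[OF that(1)] that(2) by (simp add: line_def atLeast0LessThan)
    also have "\<dots> = set (row i)"
      by (auto simp: set_conv_nth)
    also have "\<dots> = {..<b}"
      using rigid_set row[OF that(1)] by fastforce
    finally show ?thesis .
  qed
  have H: "uniform_dihypergraph k V E"
    unfolding uniform_dihypergraph_def
  proof
    fix e
    assume "e \<in> E"
    then obtain ps h where e: "e = edge ps h" and ps: "inj_on ps {1..k}" and h: "set h = {..<m}"
      by (auto simp: E_def)
    have upt: "set [1..<Suc k] = {1..k}"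
      by auto
    have "length e = k"
      by (simp add: e edge_def)
    moreover have "set e \<subseteq> V"
      using set_line[OF _ h] unfolding e edge_def V_def set_map upt by auto
    moreover have "distinct e"
      unfolding e edge_def distinct_map upt
    proof (intro conjI inj_onI)
      show "i = j" if "i \<in> {1..k}" "j \<in> {1..k}" "\<iota> (ps i, line i h) = \<iota> (ps j, line j h)" for i j
        using injD[OF \<open>inj \<iota>\<close> that(3)] inj_onD[OF ps _ that(1,2)] by simp
    qed simp
    ultimately show "length e = k \<and> set e \<subseteq> V \<and> distinct e"
      by blast
  qed
  define word where "word v = snd (inv \<iota> v)" for v
  have word: "word (\<iota> (p, x)) = x" for p x
    by (simp add: word_def inv_f_f[OF \<open>inj \<iota>\<close>])
  \<comment> \<open>Along a run, the set of positions whose letter contains the current state can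
    only grow; the words keep their length, so positions can be compared.\<close>
  have invariant: "length (word v) = length (word u) \<and> (\<forall>l<length (word v). s \<in> D (word v ! l) \<longrightarrow> t \<in> D (word u ! l))"
    if "(machine_step k S f E)\<^sup>*\<^sup>* (v, s) (u, t)" for v s u t
    using that
  proof (induction rule: rtranclp_induct2)
    case refl
    show ?case by simp
  next
    case (step u t u' t')
    then obtain e i j where e: "e \<in> E" and ij: "i \<in> {1..k}" "j \<in> {1..k}"
      and uu': "coord e i = u" "coord e j = u'" and t: "t' \<in> f t (i, j)" "t \<in> S"
      unfolding machine_step_def by blast
    obtain ps h where "e = edge ps h" and h: "set h = {..<m}"
      using e unfolding E_def by blast
    then have "u = \<iota> (ps i, line i h)" "u' = \<iota> (ps j, line j h)"
      using uu' coord[OF ij(1)] coord[OF ij(2)] by blast+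
    then have words: "word u = line i h" "word u' = line j h"
      by (simp_all only: word)
    have "t' \<in> D (word u' ! l)" if "l < length (word u)" "t \<in> D (word u ! l)" for l
    proof -
      have "h ! l < m"
        using that(1) h nth_mem[of l h] by (auto simp: words line_def)
      then show ?thesis
        using that assms(4)[OF t(2) ij t(1)] by (simp add: words line_def)
    qed
    moreover have "length (word u) = length (word u')"
      by (simp add: words line_def)
    ultimately show ?case
      using step.IH by metis
  qed
  have "good_hypergraph k S f B V E"
  proof (rule good_hypergraphI[OF H])
    fix v s t
    assume "v \<in> V" "s \<in> S" "t \<in> S" and reach: "(machine_step k S f E)\<^sup>*\<^sup>* (v, s) (v, t)"
    obtain a where a: "a < b" "s \<in> D a" "\<forall>t\<in>S. t \<in> D a \<longrightarrow> (s, t) \<notin> B"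
      using D[OF \<open>s \<in> S\<close>] by blast
    obtain p x where "v = \<iota> (p, x)" "set x = {..<b}"
      using \<open>v \<in> V\<close> unfolding V_def by blast
    then have "set (word v) = {..<b}"
      by (simp only: word)
    then obtain l where "l < length (word v)" "word v ! l = a"
      using a(1) by (metis in_set_conv_nth lessThan_iff)
    then have "t \<in> D a"
      using invariant[OF reach] a(2) by blast
    then show "(s, t) \<notin> B"
      using a(3) \<open>t \<in> S\<close> by blast
  qed
  moreover have "\<not> proper_colouring k V E \<chi> c" for \<chi> c
  proof
    assume proper: "proper_colouring k V E \<chi> c"
    \<comment> \<open>The Ramsey statement asks for a colouring of all words, so words that are no
      vertices get the value \<open>0\<close>; with the colours \<open>1, ..., \<chi>\<close> this
      makes \<open>Suc \<chi>\<close> values.\<close>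
    define col where "col p x = (if set x = {..<b} then c (\<iota> (p, x)) else 0)" for p x
    have col_less: "col p x < Suc \<chi>" for p x
      using proper unfolding proper_colouring_def V_def col_def by (auto simp: Pi_iff less_Suc_eq_le)
    obtain n where n: "\<And>c :: nat list \<Rightarrow> nat. (\<forall>x. c x < Suc \<chi>) \<Longrightarrow>
       \<exists>h. length h \<le> n \<and> set h = {..<m} \<and>
        (\<forall>g g'. rigid 0 b g \<longrightarrow> rigid 0 b g' \<longrightarrow> length g = m \<longrightarrow> length g' = m \<longrightarrow>
           c (map ((!) g) h) = c (map ((!) g') h))"
      using rigid_words_ramsey[of "Suc \<chi>" m b] by blast
    define W where "W = {x :: nat list. set x \<subseteq> {..<b} \<and> length x \<le> n}"
    have "finite W"
      unfolding W_def by (rule finite_short_words)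
    \<comment> \<open>Each number \<open>p\<close> colours the words in its own way, but on the
      finite set \<open>W\<close> only finitely many ways exist. So infinitely many numbers share
      one, \<open>ps\<close> picks distinct numbers among them, and the Ramsey statement is applied
      to the common colouring \<open>col p0\<close>.\<close>
    have "(\<lambda>p. restrict (col p) W) ` UNIV \<subseteq> W \<rightarrow>\<^sub>E {..<Suc \<chi>}"
      using col_less by auto
    then have "finite ((\<lambda>p. restrict (col p) W) ` UNIV)"
      by (rule finite_subset) (intro finite_PiE \<open>finite W\<close>, simp)
    then obtain p0 where p0: "infinite {p \<in> UNIV. restrict (col p) W = restrict (col p0) W}"
      using pigeonhole_infinite[OF infinite_UNIV_nat] by blast
    then obtain ps :: "nat \<Rightarrow> nat" where ps: "inj ps"
      "range ps \<subseteq> {p \<in> UNIV. restrict (col p) W = restrict (col p0) W}"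
      using infinite_countable_subset by blast
    have col_ps: "col (ps i) x = col p0 x" if "x \<in> W" for i x
    proof -
      have "restrict (col (ps i)) W = restrict (col p0) W"
        using ps(2) by blast
      then show ?thesis
        using that by (metis restrict_apply')
    qed
    obtain h where h: "length h \<le> n" "set h = {..<m}"
      "\<And>g g'. rigid 0 b g \<Longrightarrow> rigid 0 b g' \<Longrightarrow> length g = m \<Longrightarrow> length g' = m \<Longrightarrow>
           col p0 (map ((!) g) h) = col p0 (map ((!) g') h)"
      using n[of "col p0"] col_less by blast
    have "edge ps h \<in> E"
      using ps(1) h(2) unfolding E_def by (auto intro: inj_on_subset)
    moreover have "c (coord (edge ps h) i) = c (coord (edge ps h) j)"
      if ij: "i \<in> {1..k}" "j \<in> {1..k}" for i j
    proof -
      have c_eq: "c (coord (edge ps h) i) = col p0 (line i h)" if "i \<in> {1..k}" for i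
      proof -
        have "line i h \<in> W"
          using set_line[OF that h(2)] h(1) by (simp add: W_def line_def)
        then have "col p0 (line i h) = col (ps i) (line i h)"
          by (simp add: col_ps)
        also have "\<dots> = c (\<iota> (ps i, line i h))"
          using set_line[OF that h(2)] by (simp add: col_def)
        finally show ?thesis
          by (simp add: coord[OF that])
      qed
      have "col p0 (line i h) = col p0 (line j h)"
        unfolding line_def using row[OF ij(1)] row[OF ij(2)] by (intro h(3)) auto
      then show ?thesis
        using c_eq ij by simp
    qed
    ultimately show False
      using proper unfolding proper_colouring_def by blast
  qed
  then have "{enat \<chi> |\<chi>. \<exists>c. proper_colouring k V E \<chi> c} = {}"
    by blast
  then have "chromatic_number k V E = \<infinity>"
    unfolding chromatic_number_def by (simp only: Inf_empty top_enat_def)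
  ultimately show ?thesis
    using H by blast
qed

lemma good_hypergraph_of_compatible_system:
  assumes "infinite (UNIV :: 'v set)" "1 \<le> k" and M: "machine k S f B"
    and sys: "order_system (S \<times> {1..k}) \<Omega>" and comp: "compatible k S f B \<Omega>"
  shows "\<exists>(V :: 'v set) E. uniform_dihypergraph k V E \<and> good_hypergraph k S f B V E \<and>
    chromatic_number k V E = \<infinity>"
proof -
  define X where "X = S \<times> {1..k}"
  obtain P T where op: "order_pair (S \<times> {1..k}) P T" and \<Omega>: "\<Omega> = triple_of (S \<times> {1..k}) P T"
    using order_system_imp_triple_of[OF sys] by blast
  have opX: "order_pair X P T"
    using op by (simp only: X_def)
  note comp' = comp[unfolded \<Omega> compatible_triple_of_iff[OF op M]]
  have step: "P (s, i) (t, j)" if "s \<in> S" "i \<in> {1..k}" "j \<in> {1..k}" "t \<in> f s (i, j)" for s i j t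
    using comp' that by blast
  have same: "triple_of S (\<lambda>s t. P (s, i) (t, i)) (\<lambda>s t. T (s, i) (t, i)) =
        triple_of S (\<lambda>s t. P (s, j) (t, j)) (\<lambda>s t. T (s, j) (t, j))"
    if "i \<in> {1..k}" "j \<in> {1..k}" for i j
    using comp' that by blast
  have notB: "(s, t) \<notin> B" if "i \<in> {1..k}" "s \<in> S" "t \<in> S" "P (s, i) (t, i)" for s t i
    using comp' that by blast
  have op_copy: "order_pair S (\<lambda>s t. P (s, i) (t, i)) (\<lambda>s t. T (s, i) (t, i))" if "i \<in> {1..k}" for i
    by (rule order_pair_image[OF op]) (use that in auto)
  note copy = triple_of_inject[OF op_copy op_copy same]
  have "finite S"
    using M by (simp add: machine_def)
  then have "finite X"
    by (simp add: X_def)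
  then obtain rk :: "_ \<Rightarrow> nat" where rk: "\<forall>x\<in>X. \<forall>y\<in>X. rk x \<le> rk y \<longleftrightarrow> T x y"
    using total_preorder_rank[OF _ opX] by blast
  have rk': "rk (s, i) \<le> rk (t, j) \<longleftrightarrow> T (s, i) (t, j)"
    if "s \<in> S" "t \<in> S" "i \<in> {1..k}" "j \<in> {1..k}" for s t i j
    using rk that unfolding X_def by blast
  have one: "1 \<in> {1..k}"
    using \<open>1 \<le> k\<close> by simp
  have "\<exists>b m D row. (\<forall>i\<in>{1..k}. rigid 0 b (row i) \<and> length (row i) = m) \<and>
      (\<forall>s\<in>S. \<forall>t\<in>S. \<forall>i\<in>{1..k}. \<forall>j\<in>{1..k}. P (s, i) (t, j) \<longrightarrow>
        (\<forall>l<m. s \<in> D (row i ! l) \<longrightarrow> t \<in> D (row j ! l))) \<and>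
      (\<forall>s\<in>S. \<exists>v<b. D v = {t \<in> S. P (s, 1) (t, 1)})"
  proof (rule rigid_rows[of S k P rk])
    show "P x x" if "x \<in> S \<times> {1..k}" for x
      using order_pairD(1)[OF op that] .
    show "P x z" if "x \<in> S \<times> {1..k}" "y \<in> S \<times> {1..k}" "z \<in> S \<times> {1..k}" "P x y" "P y z" for x y z
      using order_pairD(2)[OF op that] .
    show "rk x \<le> rk y" if "x \<in> S \<times> {1..k}" "y \<in> S \<times> {1..k}" "P x y" for x y
      using order_pairD(5)[OF op that] rk that unfolding X_def by blast
    show "P x y" if "x \<in> S \<times> {1..k}" "y \<in> S \<times> {1..k}" "rk x = rk y" for x y
    proof -
      have "T x y" "T y x"
        using rk that unfolding X_def by (metis order_refl)+
      then show ?thesis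
        using order_pairD(6)[OF op that(1,2)] by blast
    qed
    show "P (s, i) (t, i) \<longleftrightarrow> P (s, j) (t, j)"
      if "s \<in> S" "t \<in> S" "i \<in> {1..k}" "j \<in> {1..k}" for s t i j
      using copy(1)[OF that(3,4,3,4,1,2)] .
    show "rk (s, i) \<le> rk (t, i) \<longleftrightarrow> rk (s, j) \<le> rk (t, j)"
      if "s \<in> S" "t \<in> S" "i \<in> {1..k}" "j \<in> {1..k}" for s t i j
      using copy(2)[OF that(3,4,3,4,1,2)] rk'[OF that(1,2,3,3)] rk'[OF that(1,2,4,4)] by blast
  qed (use \<open>finite S\<close> \<open>1 \<le> k\<close> in blast)+
  then obtain b m D row where rows: "\<forall>i\<in>{1..k}. rigid 0 b (row i) \<and> length (row i) = m"
    "\<forall>s\<in>S. \<forall>t\<in>S. \<forall>i\<in>{1..k}. \<forall>j\<in>{1..k}. P (s, i) (t, j) \<longrightarrow>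
        (\<forall>l<m. s \<in> D (row i ! l) \<longrightarrow> t \<in> D (row j ! l))"
    "\<forall>s\<in>S. \<exists>v<b. D v = {t \<in> S. P (s, 1) (t, 1)}"
    by (elim exE conjE)
  show ?thesis
  proof (rule good_hypergraph_of_rows[OF assms(1) M])
    show "rigid 0 b (row i) \<and> length (row i) = m" if "i \<in> {1..k}" for i
      using rows(1) that by blast
    show "t \<in> D (row j ! l)"
      if "s \<in> S" "i \<in> {1..k}" "j \<in> {1..k}" "t \<in> f s (i, j)" "l < m" "s \<in> D (row i ! l)" for s t i j l
    proof -
      have "t \<in> S"
        using M that(1-4) unfolding machine_def by blast
      then show ?thesis
        using rows(2) step[OF that(1-4)] that by blast
    qed
    \<comment> \<open>The letter wanted is the principal up-set of \<open>s\<close>: all its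
      elements \<open>t\<close> satisfy \<open>P (s, 1) (t, 1)\<close>, and condition (3) keeps
      \<open>(s, t)\<close> out of \<open>B\<close>.\<close>
    show "\<exists>v<b. s \<in> D v \<and> (\<forall>t\<in>S. t \<in> D v \<longrightarrow> (s, t) \<notin> B)" if s: "s \<in> S" for s
    proof -
      obtain v where v: "v < b" "D v = {t \<in> S. P (s, 1) (t, 1)}"
        using rows(3) s by blast
      have "P (s, 1) (s, 1)"
        using order_pairD(1)[OF op] s one by blast
      then show ?thesis
        using v notB[OF one s] s by blast
    qed
  qed
qed

text \<open>A single good hypergraph beyond \<open>card {\<Omega>. order_system S \<Omega>}\<close>
  yields a compatible system, and this yields a good hypergraph of chromatic number
  \<open>\<infinity>\<close>. So chromatic numbers either stay within that bound or are unbounded,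
  which gives both claims.\<close>

theorem theorem6:
  fixes k :: nat
    and S :: "'s set"
    and f :: "'s \<Rightarrow> nat \<times> nat \<Rightarrow> 's set"
    and B :: "('s \<times> 's) set"
  assumes "k \<ge> 1"
    and "machine k S f B"
    and "infinite (UNIV :: 'v set)"
  shows "((\<forall>N :: nat. \<exists>(V :: 'v set) E. uniform_dihypergraph k V E \<and> good_hypergraph k S f B V E
              \<and> chromatic_number k V E \<ge> enat N)
           \<longleftrightarrow> (\<exists>\<Omega>. order_system (S \<times> {1..k}) \<Omega> \<and> compatible k S f B \<Omega>))
       \<and> ((\<exists>N :: nat. \<forall>(V :: 'v set) E. uniform_dihypergraph k V E \<and> good_hypergraph k S f B V E
              \<longrightarrow> chromatic_number k V E \<le> enat N)
           \<longrightarrow> (\<forall>(V :: 'v set) E. uniform_dihypergraph k V E \<and> good_hypergraph k S f B V E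
              \<longrightarrow> chromatic_number k V E \<le> enat (card {\<Omega>. order_system S \<Omega>})))"
proof -
  let ?\<chi> = "card {\<Omega>. order_system S \<Omega>}"
  let ?comp = "\<exists>\<Omega>. order_system (S \<times> {1..k}) \<Omega> \<and> compatible k S f B \<Omega>"
  let ?good = "\<lambda>(V :: 'v set) E. uniform_dihypergraph k V E \<and> good_hypergraph k S f B V E"
  have comp: ?comp if "?good V E" "\<not> chromatic_number k V E \<le> enat ?\<chi>" for V E
    using compatible_system_of_chromatic_number[OF assms(2)] that by blast
  have large: "\<exists>V E. ?good V E \<and> chromatic_number k V E = \<infinity>" if ?comp
    using good_hypergraph_of_compatible_system[OF assms(3,1,2)] that by blast
  show ?thesis
  proof (intro conjI iffI allI impI)
    assume "\<forall>N. \<exists>(V :: 'v set) E. uniform_dihypergraph k V E \<and> good_hypergraph k S f B V E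
              \<and> chromatic_number k V E \<ge> enat N"
    then obtain V :: "'v set" and E where "?good V E" "chromatic_number k V E \<ge> enat (Suc ?\<chi>)"
      by blast
    moreover from this(2) have "\<not> chromatic_number k V E \<le> enat ?\<chi>"
      by (metis Suc_n_not_le_n enat_ord_simps(1) order_trans)
    ultimately show ?comp
      using comp by blast
  next
    fix N
    assume ?comp
    from large[OF this] show "\<exists>(V :: 'v set) E. uniform_dihypergraph k V E \<and> good_hypergraph k S f B V E
              \<and> chromatic_number k V E \<ge> enat N"
      by (metis enat_ord_code(3))
  next
    fix V :: "'v set" and E
    assume bounded: "\<exists>N. \<forall>(V :: 'v set) E. uniform_dihypergraph k V E \<and> good_hypergraph k S f B V E
              \<longrightarrow> chromatic_number k V E \<le> enat N" and good: "?good V E"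
    show "chromatic_number k V E \<le> enat ?\<chi>"
    proof (rule ccontr)
      assume "\<not> chromatic_number k V E \<le> enat ?\<chi>"
      from large[OF comp[OF good this]] obtain V' :: "'v set" and E'
        where "?good V' E'" "chromatic_number k V' E' = \<infinity>"
        by blast
      then show False
        using bounded by force
    qed
  qed
qed

end
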